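(* Consider the perfect-acknowledgment optimal transmission problem $$\min_{\{\nu_k\}}\ \limsup_{T\to\infty}\frac1T\sum_{k=0}^{T-1}\mathbb{E}\big[\lambda\,\mathrm{Tr}\,P^{1,1}_{k+1}+(1-\lambda)J(\nu_k)\big],\qquad \mathbf P_{k+1}=\mathcal L(\mathbf P_k,\gamma_k,\nu_k),$$ where $P^{1,1}_{k}$ denotes the upper-left $n\times n$ block of $\mathbf P_k$, $\lambda\in[0,1]$, and the minimization is over causal policies in which $\nu_k\in\{0,1\}$ is a function of $\gamma_0,\dots,\gamma_{k-1},\nu_0,\dots,\nu_{k-1}$ and $P_{x_0}$ (equivalently, at time $k$ the sensor knows $\mathbf P_0,\dots,\mathbf P_k$). Then, independently of the initial estimation error covariance $P_{x_0}$, the value of this problem is a constant $\rho$ which, together with a function $V:\mathbb S\to\mathbb R$ (the relative value function), solves the average cost optimality (Bellman) equation $$\rho+V(\mathbf P)=\min_{\nu\in\{0,1\}}\Big(\mathbb E\big[\lambda\,\mathrm{Tr}\,\mathcal L^{1,1}(\mathbf P,\gamma,\nu)+(1-\lambda)J(\nu)\,\big|\,\mathbf P,\nu\big]+\mathbb E\big[V(\mathcal L(\mathbf P,\gamma,\nu))\,\big|\,\mathbf P,\nu\big]\Big),\qquad \mathbf P\in\mathbb S,$$ where the expectations are over a Bernoulli random variable $\gamma$ with $\mathbb P(\gamma=1)=1-p$.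
   Context: Data. $A\in\mathbb R^{n\times n}$ is Schur stable, $C\in\mathbb R^{m\times n}$, $(A,C)$ is detectable, $\Sigma_w\ge0$, $\Sigma_v>0$ are noise covariances (of the process $x_{k+1}=Ax_k+w_k$ and measurement $y_k=Cx_k+v_k$). $P_s\ge0$ solves the algebraic Riccati equation $P_s=AP_sA^T+\Sigma_w-AP_sC^T(CP_sC^T+\Sigma_v)^{-1}CP_sA^T$; $K_f=P_sC^T(CP_sC^T+\Sigma_v)^{-1}$, $K_s=AK_f$; $\Sigma_s$ solves $\Sigma_s=A\Sigma_sA^T+K_s(CP_sC^T+\Sigma_v)K_s^T$. For given $\alpha_0,\alpha_1\ge0$ (chosen so that the two traces below agree), the quantization noise covariances are $\Sigma_q^x=\alpha_1\big(\Sigma_s+K_f(CP_sC^T+\Sigma_v)K_f^T\big)$ and $\Sigma_q^\epsilon=\alpha_0K_f(CP_sC^T+\Sigma_v)K_f^T$, with $\mathrm{Tr}\,\Sigma_q^x=\mathrm{Tr}\,\Sigma_q^\epsilon$. For $\nu\in\{0,1\}$ (with $\nu=1$: a quantized local state estimate is transmitted; $\nu=0$: a quantized local innovation is transmitted) put $$\mathcal A=\begin{bmatrix} A & 0 \\ K_sC & A-K_sC \end{bmatrix},\quad \mathcal C(\nu)=[K_fC\ \ \nu I-K_fC],\quad Q=\begin{bmatrix} \Sigma_w & 0 \\ 0 & K_s\Sigma_vK_s^T \end{bmatrix},\quad S=\begin{bmatrix} 0 \\ K_s\Sigma_vK_f^T \end{bmatrix},$$ $R(\nu)=K_f\Sigma_vK_f^T+\nu^2\Sigma_q^x+(1-\nu)^2\Sigma_q^\epsilon$.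 The Riccati operator is $$\mathcal L(\mathbf P,\gamma,\nu)=\mathcal A\mathbf P\mathcal A^T+Q-\gamma[\mathcal A\mathbf P\mathcal C^T(\nu)+S][\mathcal C(\nu)\mathbf P\mathcal C^T(\nu)+R(\nu)]^{-1}[\mathcal A\mathbf P\mathcal C^T(\nu)+S]^T,$$ (the inverse is assumed to exist), and $\mathcal L^{1,1}$ is its upper-left $n\times n$ block. The state space is $$\mathbb S=\left\{\begin{bmatrix} P & P-P_s \\ P-P_s & P-P_s \end{bmatrix}:P\ge P_s\right\},$$ which $\mathcal L(\cdot,\gamma,\nu)$ maps into itself; $\mathbf P_0\in\mathbb S$ is the element with upper-left block $P_{x_0}$. $\mathbf P_k$ is the one-step prediction error covariance of the augmented state at the remote receiver. The packet-reception variables $\gamma_k\in\{0,1\}$ are i.i.d. with $\mathbb P(\gamma_k=1)=1-p$, $p\in[0,1]$. $J(\nu)=n_\nu E_b^\nu$ is the energy needed to transmit a packet, where $n_0\le n_1$ are the bit rates and $0\le E_b^0\le E_b^1$ the energies per bit that maintain packet loss probability $p$; thus $J(0)\le J(1)$ are given nonnegative constants. Order between symmetric matrices is the positive semidefinite order. *)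

theory Defs
  imports "HOL-Probability.Probability"
begin

section \<open>Linear systems and symmetric matrices\<close>

definition psd :: "real^'n^'n \<Rightarrow> bool" where
  "psd M \<longleftrightarrow> transpose M = M \<and> (\<forall>x. 0 \<le> x \<bullet> (M *v x))"

definition pos_def :: "real^'n^'n \<Rightarrow> bool" where
  "pos_def M \<longleftrightarrow> transpose M = M \<and> (\<forall>x. x \<noteq> 0 \<longrightarrow> 0 < x \<bullet> (M *v x))"

definition schur_stable :: "real^'n^'n \<Rightarrow> bool" where
  "schur_stable A \<longleftrightarrow>
     (\<forall>c v. v \<noteq> 0 \<and> map_matrix complex_of_real A *v v = c *s v \<longrightarrow> cmod c < 1)"

definition detectable :: "real^'n^'n \<Rightarrow> real^'n^'m \<Rightarrow> bool" where
  "detectable A C \<longleftrightarrow> (\<exists>L :: real^'m^'n. schur_stable (A - L ** C))"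


section \<open>Block matrices\<close>

text \<open>An augmented dimension is the index type \<^typ>\<open>'a + 'b\<close>; \<^const>\<open>Inl\<close> indexes the
  upper or left block.\<close>

definition hcat :: "real^'a^'r \<Rightarrow> real^'b^'r \<Rightarrow> real^('a + 'b)^'r" where
  "hcat M N = (\<chi> i j. case j of Inl k \<Rightarrow> M $ i $ k | Inr k \<Rightarrow> N $ i $ k)"

definition vcat :: "real^'c^'a \<Rightarrow> real^'c^'b \<Rightarrow> real^'c^('a + 'b)" where
  "vcat M N = (\<chi> i. case i of Inl k \<Rightarrow> M $ k | Inr k \<Rightarrow> N $ k)"

definition block ::
  "real^'a^'r \<Rightarrow> real^'b^'r \<Rightarrow> real^'a^'s \<Rightarrow> real^'b^'s \<Rightarrow> real^('a + 'b)^('r + 's)" where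
  "block M11 M12 M21 M22 = vcat (hcat M11 M12) (hcat M21 M22)"

definition upper_left :: "real^('a::finite + 'b::finite)^('r::finite + 's::finite) \<Rightarrow> real^'a^'r" where
  "upper_left M = (\<chi> i j. M $ Inl i $ Inl j)"


section \<open>The Riccati operator and its state space\<close>

definition innovation_cov ::
  "(real \<Rightarrow> real^'d^'n) \<Rightarrow> (real \<Rightarrow> real^'n^'n) \<Rightarrow> real^'d^'d \<Rightarrow> real \<Rightarrow> real^'n^'n" where
  "innovation_cov CC R P \<nu> = CC \<nu> ** P ** transpose (CC \<nu>) + R \<nu>"

definition riccati ::
  "real^'d^'d \<Rightarrow> (real \<Rightarrow> real^'d^'n) \<Rightarrow> real^'d^'d \<Rightarrow> real^'n^'d \<Rightarrow> (real \<Rightarrow> real^'n^'n)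
    \<Rightarrow> real^'d^'d \<Rightarrow> real \<Rightarrow> real \<Rightarrow> real^'d^'d" where
  "riccati AA CC Q S R P \<gamma> \<nu> =
     AA ** P ** transpose AA + Q
     - \<gamma> *\<^sub>R ((AA ** P ** transpose (CC \<nu>) + S)
            ** matrix_inv (innovation_cov CC R P \<nu>)
            ** transpose (AA ** P ** transpose (CC \<nu>) + S))"

definition embed :: "real^'n^'n \<Rightarrow> real^'n^'n \<Rightarrow> real^('n + 'n)^('n + 'n)" where
  "embed Ps P = block P (P - Ps) (P - Ps) (P - Ps)"

definition state_space :: "real^'n^'n \<Rightarrow> (real^('n + 'n)^('n + 'n)) set" where
  "state_space Ps = {embed Ps P | P. psd (P - Ps)}"


section \<open>Causal policies and the long-run average cost\<close>

text \<open>A policy receives the list of past receptions, the list of past decisions and the initial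
  covariance. The current time is the length of these lists.\<close>

type_synonym 'n policy = "real list \<Rightarrow> real list \<Rightarrow> real^'n^'n \<Rightarrow> real"

definition policies :: "'n policy set" where
  "policies = {\<pi>. \<forall>gs vs P. \<pi> gs vs P \<in> {0, 1}}"

primrec decisions :: "'n policy \<Rightarrow> real^'n^'n \<Rightarrow> (nat \<Rightarrow> real) \<Rightarrow> nat \<Rightarrow> real list" where
  "decisions \<pi> P0 g 0 = []"
| "decisions \<pi> P0 g (Suc k) =
     decisions \<pi> P0 g k @ [\<pi> (map g [0..<k]) (decisions \<pi> P0 g k) P0]"

definition decision :: "'n policy \<Rightarrow> real^'n^'n \<Rightarrow> (nat \<Rightarrow> real) \<Rightarrow> nat \<Rightarrow> real" where
  "decision \<pi> P0 g k = \<pi> (map g [0..<k]) (decisions \<pi> P0 g k) P0"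

primrec trajectory ::
  "(real^('n + 'n)^('n + 'n) \<Rightarrow> real \<Rightarrow> real \<Rightarrow> real^('n + 'n)^('n + 'n)) \<Rightarrow> real^'n^'n
    \<Rightarrow> 'n policy \<Rightarrow> real^'n^'n \<Rightarrow> (nat \<Rightarrow> real) \<Rightarrow> nat \<Rightarrow> real^('n + 'n)^('n + 'n)" where
  "trajectory L Ps \<pi> P0 g 0 = embed Ps P0"
| "trajectory L Ps \<pi> P0 g (Suc k) = L (trajectory L Ps \<pi> P0 g k) (g k) (decision \<pi> P0 g k)"

definition average_cost ::
  "'w measure \<Rightarrow> (nat \<Rightarrow> 'w \<Rightarrow> real)
    \<Rightarrow> (real^('n + 'n)^('n + 'n) \<Rightarrow> real \<Rightarrow> real \<Rightarrow> real^('n + 'n)^('n + 'n)) \<Rightarrow> real^'n^'n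
    \<Rightarrow> (real \<Rightarrow> real) \<Rightarrow> real \<Rightarrow> 'n policy \<Rightarrow> real^'n^'n \<Rightarrow> ereal" where
  "average_cost M \<gamma> L Ps J lam \<pi> P0 =
     limsup (\<lambda>T. ereal (1 / real T *
       (\<Sum>k<T. \<integral>\<omega>. lam * trace (upper_left (trajectory L Ps \<pi> P0 (\<lambda>i. \<gamma> i \<omega>) (Suc k)))
                    + (1 - lam) * J (decision \<pi> P0 (\<lambda>i. \<gamma> i \<omega>) k) \<partial>M)))"

end

theory Submission
  imports Defs "HOL-Computational_Algebra.Fundamental_Theorem_Algebra"
begin

text \<open>Write the upper-left block of a state as \<open>Ps + D\<close>. The Riccati equation for \<open>Ps\<close> makes all
  four blocks of the next state depend on \<open>D\<close> alone: with \<open>W = Kf (C Ps C\<^sup>T + \<Sigma>v) Kf\<^sup>T\<close> the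
  excess covariance moves to \<open>A G A\<^sup>T\<close>, where \<open>G\<close> is \<open>D + W\<close> after a loss, \<open>D\<close> plus a constant after a
  received innovation, and \<open>h (D + W)\<close> after a received state estimate, \<open>h\<close> being the covariance
  update for a measurement with noise \<open>\<Sigma>qx\<close> (lemma \<open>riccati_embed\<close>).

  The whole argument rests on one contraction. Put \<open>\<Theta> = \<Sigma>s + W\<close>. The Lyapunov equation of \<open>\<Sigma>s\<close>
  reads \<open>A \<Theta> A\<^sup>T = \<Theta> - W\<close>. The innovation covariance is invertible at \<open>\<nu> = 0\<close>, so \<open>W\<close> is positive
  definite and \<open>A \<Theta> A\<^sup>T \<le> \<kappa> \<Theta>\<close> for some \<open>\<kappa> < 1\<close>. A measurement update can expand a
  perturbation of its prior in the semidefinite order. But \<open>\<Sigma>qx = \<alpha>1 \<Theta>\<close> is proportional to \<open>\<Theta>\<close>, and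
  with that noise a perturbation \<open>s \<Theta>\<close> is never expanded (lemma \<open>filtered_cov_nonexpansive\<close>).
  Consequently \<open>D1 \<le> D2 + s \<Theta>\<close> implies the same relation with \<open>\<kappa> s\<close> one step later, whatever the
  decision and the reception.

  This gives the optimality equation by vanishing discount. Discounted value iteration preserves the
  slope bound \<open>V x \<le> V y + c s\<close> whenever \<open>x \<le> y + s \<Theta>\<close>, with \<open>c\<close> independent of the discount factor
  \<open>\<alpha>\<close>, so the differences \<open>V\<^sub>\<alpha> x - V\<^sub>\<alpha> x\<^sub>0\<close> stay in compact intervals. By Tychonoff they have a
  pointwise cluster point as \<open>\<alpha> \<rightarrow> 1\<close>. Only two successors occur for each decision, so pointwise
  convergence is enough to pass to the limit in the discounted Bellman equation
  (lemma \<open>average_cost_optimality_equation\<close>).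

  Finally \<open>V\<close> is bounded along every trajectory, since the excess covariance stays below a fixed
  multiple of \<open>\<Theta>\<close>. Summing the optimality equation over \<open>T\<close> steps therefore leaves only a bounded
  boundary term, which disappears in the average: every policy costs at least \<open>\<rho>\<close>, and the policy
  that minimizes the right-hand side costs exactly \<open>\<rho>\<close>.\<close>

section \<open>Matrix algebra and the positive semidefinite order\<close>

lemma matrix_diff_ldistrib: "A ** (B - C) = A ** B - A ** (C :: real^'c^'b)" for A :: "real^'b^'a"
  by (simp add: matrix_matrix_mult_def vec_eq_iff sum_subtractf right_diff_distrib)

lemma matrix_diff_rdistrib: "(A - B) ** C = A ** C - B ** (C :: real^'c^'b)" for A :: "real^'b^'a"
  by (simp add: matrix_matrix_mult_def vec_eq_iff sum_subtractf left_diff_distrib)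

lemma matrix_add_rdistrib: "(A + B) ** C = A ** C + B ** (C :: real^'c^'b)" for A :: "real^'b^'a"
  by (simp add: matrix_matrix_mult_def vec_eq_iff sum.distrib distrib_right)

lemma matrix_scaleR_left: "(r *\<^sub>R A) ** C = r *\<^sub>R (A ** (C :: real^'c^'b))" for A :: "real^'b^'a"
  by (simp add: matrix_matrix_mult_def vec_eq_iff sum_distrib_left mult.assoc)

lemma matrix_scaleR_right: "A ** (r *\<^sub>R C) = r *\<^sub>R (A ** (C :: real^'c^'b))" for A :: "real^'b^'a"
  by (simp add: matrix_matrix_mult_def vec_eq_iff sum_distrib_left mult.left_commute)

lemma matrix_mult_zero: "(0 :: real^'b^'a) ** (B :: real^'c^'b) = 0" "(A :: real^'b^'a) ** (0 :: real^'c^'b) = 0"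
  by (simp_all add: matrix_matrix_mult_def vec_eq_iff)

lemmas matrix_ring = matrix_add_ldistrib matrix_add_rdistrib matrix_diff_ldistrib matrix_diff_rdistrib
  matrix_scaleR_left matrix_scaleR_right matrix_mult_zero matrix_mul_assoc

lemma transpose_linear:
  "transpose (A + B) = transpose A + transpose (B :: real^'b^'a)"
  "transpose (A - B) = transpose A - transpose (B :: real^'b^'a)"
  "transpose (r *\<^sub>R A) = r *\<^sub>R transpose (A :: real^'b^'a)"
  "transpose (0 :: real^'b^'a) = 0"
  by (simp_all add: transpose_def vec_eq_iff)

lemma inner_transpose: "(transpose A *v x) \<bullet> y = x \<bullet> (A *v y)" for A :: "real^'b^'a"
  by (metis dot_lmul_matrix vector_transpose_matrix transpose_transpose)

lemma psd_symmetric: "psd M \<Longrightarrow> transpose M = M"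
  by (simp add: psd_def)

lemma psd_zero: "psd 0"
  by (simp add: psd_def transpose_linear)

lemma psd_add: "psd A \<Longrightarrow> psd B \<Longrightarrow> psd (A + B)"
  by (simp add: psd_def transpose_linear matrix_vector_mult_add_rdistrib inner_add_right)

lemma psd_scaleR: "0 \<le> r \<Longrightarrow> psd A \<Longrightarrow> psd (r *\<^sub>R A)"
  by (simp add: psd_def transpose_linear scaleR_matrix_vector_assoc[symmetric])

lemma psd_congruence: "psd M \<Longrightarrow> psd (X ** M ** transpose X)" for X :: "real^'b^'a"
  by (simp add: psd_def matrix_transpose_mul matrix_mul_assoc)
     (metis inner_transpose matrix_vector_mul_assoc transpose_transpose)

lemma psd_le_trans: "psd (B - A) \<Longrightarrow> psd (C - B) \<Longrightarrow> psd (C - A)"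
  using psd_add[of "B - A" "C - B"] by (simp add: algebra_simps)

lemma psd_trace_nonneg:
  assumes "psd M" shows "0 \<le> trace M"
proof -
  have "0 \<le> M $ i $ i" for i
  proof -
    have "0 \<le> axis i 1 \<bullet> (M *v axis i 1)"
      using assms unfolding psd_def by blast
    also have "\<dots> = M $ i $ i"
      by (simp add: matrix_vector_mult_basis column_def inner_axis')
    finally show ?thesis .
  qed
  then show ?thesis by (simp add: trace_def sum_nonneg)
qed

lemma pos_def_invertible:
  assumes "pos_def M" shows "invertible M"
proof -
  have "M *v x = 0 \<Longrightarrow> x = 0" for x
    using assms unfolding pos_def_def by (metis inner_zero_right less_irrefl)
  then show ?thesis
    by (simp add: invertible_left_inverse matrix_left_invertible_ker)
qed

lemma pos_def_psd: "pos_def M \<Longrightarrow> psd M"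
  unfolding pos_def_def psd_def by (metis inner_zero_left less_le order_refl)

lemma psd_add_pos_def: "psd A \<Longrightarrow> pos_def B \<Longrightarrow> pos_def (A + B)"
  by (auto simp: psd_def pos_def_def transpose_linear matrix_vector_mult_add_rdistrib inner_add_right
      intro: add_nonneg_pos)

text \<open>A semidefinite form that vanishes at \<open>x\<close> is minimal there, so its derivative vanishes too. The
  proof perturbs \<open>x\<close> in the direction \<open>M x\<close>.\<close>

lemma psd_kernel:
  assumes "psd M" "x \<bullet> (M *v x) = 0" shows "M *v x = 0"
proof -
  define y where "y = M *v x"
  have sym: "x \<bullet> (M *v y) = y \<bullet> y"
    unfolding y_def by (metis inner_transpose psd_symmetric[OF assms(1)])
  have sym': "y \<bullet> (M *v x) = y \<bullet> y" by (simp add: y_def)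
  have *: "0 \<le> t * t * (y \<bullet> (M *v y)) + 2 * t * (y \<bullet> y)" for t
  proof -
    have "0 \<le> (x + t *\<^sub>R y) \<bullet> (M *v (x + t *\<^sub>R y))"
      using assms(1) unfolding psd_def by blast
    also have "\<dots> = t * t * (y \<bullet> (M *v y)) + 2 * t * (y \<bullet> y)"
      using assms(2)
      by (simp add: matrix_vector_right_distrib matrix_vector_mult_scaleR inner_add_left inner_add_right
          sym sym' algebra_simps)
    finally show ?thesis .
  qed
  define q where "q = y \<bullet> (M *v y)"
  have q0: "0 \<le> q" using assms(1) unfolding psd_def q_def by blast
  have "y \<bullet> y = 0"
  proof (rule ccontr)
    assume "y \<bullet> y \<noteq> 0"
    then have yy: "0 < y \<bullet> y" using inner_ge_zero[of y] by linarith
    define t where "t = - (y \<bullet> y) / (q + 1)"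
    have t: "t * (q + 1) = - (y \<bullet> y)" using q0 by (simp add: t_def)
    have "t < 0" using yy q0 by (simp add: t_def divide_neg_pos)
    have "0 \<le> t * (t * q + 2 * (y \<bullet> y))"
      using *[of t] by (simp add: q_def algebra_simps)
    then have "t * q + 2 * (y \<bullet> y) \<le> 0" using \<open>t < 0\<close> by (simp add: zero_le_mult_iff)
    moreover have "t * q = - (y \<bullet> y) - t" using t by (simp add: algebra_simps)
    ultimately show False using yy \<open>t < 0\<close> by linarith
  qed
  then show ?thesis by (simp add: y_def)
qed

lemma psd_invertible_pos_def:
  assumes "psd M" "invertible M" shows "pos_def M"
  unfolding pos_def_def
proof (intro conjI allI impI)
  show "transpose M = M" using assms(1) by (simp add: psd_def)
  fix x :: "real^'a" assume "x \<noteq> 0"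
  then have "M *v x \<noteq> 0"
    using assms(2) by (metis invertible_left_inverse matrix_left_invertible_ker)
  then have "x \<bullet> (M *v x) \<noteq> 0" using psd_kernel[OF assms(1)] by blast
  then show "0 < x \<bullet> (M *v x)" using assms(1) unfolding psd_def by (metis less_le)
qed

lemma quadratic_form_bounded:
  fixes M :: "real^'n^'n"
  obtains b where "0 < b" "\<And>x. x \<bullet> (M *v x) \<le> b * (x \<bullet> x)"
proof -
  obtain b where b: "0 < b" "\<And>x. norm (M *v x) \<le> norm x * b"
    using bounded_linear.pos_bounded[OF matrix_vector_mul_bounded_linear[of M]] by blast
  have "x \<bullet> (M *v x) \<le> b * (x \<bullet> x)" for x
  proof -
    have "x \<bullet> (M *v x) \<le> norm x * norm (M *v x)" by (rule norm_cauchy_schwarz)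
    also have "\<dots> \<le> norm x * (norm x * b)" by (intro mult_left_mono b) auto
    finally show ?thesis by (simp add: dot_square_norm power2_eq_square mult.commute mult.left_commute)
  qed
  with b(1) show ?thesis using that by blast
qed

lemma pos_def_coercive:
  fixes M :: "real^'n^'n"
  assumes "pos_def M"
  obtains a where "0 < a" "\<And>x. a * (x \<bullet> x) \<le> x \<bullet> (M *v x)"
proof -
  let ?f = "\<lambda>x. x \<bullet> (M *v x)"
  have "continuous_on (sphere 0 1) ?f"
    by (intro continuous_intros matrix_vector_mul_linear linear_continuous_on
        matrix_vector_mul_bounded_linear)
  then obtain u :: "real^'n" where u: "norm u = 1" "\<And>y. norm y = 1 \<Longrightarrow> ?f u \<le> ?f y"
    using continuous_attains_inf[of "sphere (0 :: real^'n) 1" ?f] by auto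
  have pos: "0 < ?f u" using assms u(1) unfolding pos_def_def by (metis norm_zero zero_neq_one)
  have "?f u * (x \<bullet> x) \<le> ?f x" for x
  proof (cases "x = 0")
    case False
    define y where "y = (1 / norm x) *\<^sub>R x"
    have "norm y = 1" using False by (simp add: y_def)
    then have "?f u \<le> ?f y" by (rule u(2))
    also have "\<dots> = ?f x / (norm x * norm x)"
      by (simp add: y_def matrix_vector_mult_scaleR)
    finally show ?thesis
      using False by (simp add: dot_square_norm power2_eq_square pos_le_divide_eq)
  qed simp
  with pos show ?thesis using that by blast
qed

lemma psd_le_scaleR_pos_def:
  fixes M B :: "real^'n^'n"
  assumes "transpose M = M" "pos_def B"
  obtains s where "0 < s" "psd (s *\<^sub>R B - M)"
proof -
  obtain b where b: "0 < b" "\<And>x. x \<bullet> (M *v x) \<le> b * (x \<bullet> x)"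
    using quadratic_form_bounded by blast
  obtain a where a: "0 < a" "\<And>x. a * (x \<bullet> x) \<le> x \<bullet> (B *v x)"
    using pos_def_coercive[OF assms(2)] by blast
  have "psd ((b / a) *\<^sub>R B - M)"
    unfolding psd_def
  proof (intro conjI allI)
    show "transpose ((b / a) *\<^sub>R B - M) = (b / a) *\<^sub>R B - M"
      using assms by (simp add: transpose_linear pos_def_def)
    fix x
    have "x \<bullet> (M *v x) \<le> (b / a) * (a * (x \<bullet> x))" using b(2)[of x] a(1) by simp
    also have "\<dots> \<le> (b / a) * (x \<bullet> (B *v x))" by (intro mult_left_mono a) (use a b in auto)
    finally show "0 \<le> x \<bullet> (((b / a) *\<^sub>R B - M) *v x)"
      by (simp add: matrix_vector_mult_diff_rdistrib inner_diff_right scaleR_matrix_vector_assoc[symmetric])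
  qed
  moreover have "0 < b / a" using a b by simp
  ultimately show ?thesis using that by blast
qed

lemma
  assumes "invertible (M :: real^'n^'n)"
  shows matrix_inv_left: "matrix_inv M ** M = mat 1" and matrix_inv_right: "M ** matrix_inv M = mat 1"
  using assms unfolding invertible_def matrix_inv_def by (metis (mono_tags, lifting) someI_ex)+

lemma matrix_inv_symmetric:
  assumes "invertible (M :: real^'n^'n)" "transpose M = M"
  shows "transpose (matrix_inv M) = matrix_inv M"
proof -
  have "transpose (matrix_inv M) ** M = mat 1"
    using matrix_inv_right[OF assms(1)] assms(2) by (metis matrix_transpose_mul transpose_mat)
  then have "transpose (matrix_inv M) ** (M ** matrix_inv M) = matrix_inv M"
    by (simp add: matrix_mul_assoc)
  then show ?thesis by (simp add: matrix_inv_right[OF assms(1)])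
qed

lemma psd_matrix_inv:
  assumes "invertible (M :: real^'n^'n)" "psd M" shows "psd (matrix_inv M)"
proof -
  let ?N = "matrix_inv M"
  have sym: "transpose ?N = ?N" using matrix_inv_symmetric[OF assms(1)] assms(2) by (simp add: psd_def)
  have "?N ** M ** transpose ?N = ?N"
    by (simp add: sym matrix_inv_left[OF assms(1)])
  then show ?thesis using psd_congruence[OF assms(2), of ?N] by simp
qed

section \<open>Linear iterations of a Schur stable matrix\<close>

text \<open>One scalar mode of the iteration: a root \<open>c\<close> of the annihilating polynomial, driven by the
  iteration of the remaining factors.\<close>

lemma perturbed_geometric_tendsto_zero:
  fixes u e :: "nat \<Rightarrow> complex"
  assumes c: "cmod c < 1" and e: "e \<longlonglongrightarrow> 0" and u: "\<And>k. u (Suc k) = c * u k + e k"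
  shows "u \<longlonglongrightarrow> 0"
proof (rule LIMSEQ_I)
  fix r :: real assume r: "0 < r"
  let ?q = "cmod c"
  define h where "h = r / 2"
  define d where "d = h * (1 - ?q)"
  have d: "0 < d" using r c by (simp add: d_def h_def)
  obtain N where N: "\<And>k. N \<le> k \<Longrightarrow> cmod (e k) < d"
    using LIMSEQ_D[OF e d] by auto
  have bound: "cmod (u (N + j)) \<le> ?q ^ j * cmod (u N) + h" for j
  proof (induction j)
    case 0 then show ?case using r by (simp add: h_def)
  next
    case (Suc j)
    have "cmod (u (N + Suc j)) \<le> ?q * cmod (u (N + j)) + cmod (e (N + j))"
      using norm_triangle_ineq[of "c * u (N + j)" "e (N + j)"] by (simp add: u norm_mult)
    also have "\<dots> \<le> ?q * (?q ^ j * cmod (u N) + h) + d"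
      by (intro add_mono mult_left_mono Suc.IH less_imp_le[OF N]) auto
    also have "\<dots> = ?q ^ Suc j * cmod (u N) + h" by (simp add: d_def algebra_simps)
    finally show ?case .
  qed
  have "(\<lambda>j. ?q ^ j * cmod (u N)) \<longlonglongrightarrow> 0 * cmod (u N)"
    using c by (intro tendsto_mult LIMSEQ_power_zero tendsto_const) simp
  then obtain N' where N': "\<And>j. N' \<le> j \<Longrightarrow> norm (?q ^ j * cmod (u N)) < r / 2"
    using LIMSEQ_D[of "\<lambda>j. ?q ^ j * cmod (u N)" 0 "r / 2"] r by auto
  have "norm (u k - 0) < r" if "N + N' \<le> k" for k
  proof -
    define j where "j = k - N"
    have j: "k = N + j" "N' \<le> j" using that by (auto simp: j_def)
    have "?q ^ j * cmod (u N) < r / 2" using N'[OF j(2)] by (simp add: norm_mult norm_power)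
    then show ?thesis using bound[of j] by (simp add: j(1) h_def)
  qed
  then show "\<exists>no. \<forall>k\<ge>no. norm (u k - 0) < r" by blast
qed

text \<open>This is \<open>q(B) x\<close>.\<close>

definition poly_act :: "complex poly \<Rightarrow> complex^'n^'n \<Rightarrow> complex^'n \<Rightarrow> complex^'n" where
  "poly_act q B x = (\<Sum>i\<le>degree q. coeff q i *s (((*v) B) ^^ i) x)"

lemma poly_act_bound:
  assumes "degree q \<le> n"
  shows "poly_act q B x = (\<Sum>i\<le>n. coeff q i *s (((*v) B) ^^ i) x)"
  unfolding poly_act_def
  by (rule sum.mono_neutral_left) (use assms in \<open>auto simp: coeff_eq_0\<close>)

lemma matrix_power_step:
  fixes B :: "complex^'n^'n"
  shows "B *v (((*v) B) ^^ i) x = (((*v) B) ^^ i) (B *v x)"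
  by (rule funpow_swap1)

lemma matrix_power_linear:
  fixes B :: "complex^'n^'n"
  shows "(((*v) B) ^^ i) (x - c *s y) = (((*v) B) ^^ i) x - c *s (((*v) B) ^^ i) y"
proof (induction i)
  case (Suc i)
  have "(((*v) B) ^^ Suc i) (x - c *s y) = B *v ((((*v) B) ^^ i) x - c *s (((*v) B) ^^ i) y)"
    by (simp only: funpow.simps comp_def Suc.IH)
  then show ?case
    by (simp only: funpow.simps comp_def matrix_vector_mult_diff_distrib vector_scalar_commute)
qed simp

lemma matrix_mult_sum_scaled:
  "B *v (\<Sum>i\<in>I. a i *s f i) = (\<Sum>i\<in>I. a i *s (B *v f i))" for B :: "complex^'n^'n"
  by (induction I rule: infinite_finite_induct)
     (simp_all add: matrix_vector_right_distrib vector_scalar_commute)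

lemma poly_act_linear_factor:
  "poly_act ([:- c, 1:] * q) B x = poly_act q B (B *v x - c *s x)"
proof -
  define n where "n = degree q"
  have *: "[:- c, 1:] * q = pCons 0 q - smult c q" by simp
  have deg: "degree ([:- c, 1:] * q) \<le> Suc n"
  proof -
    have "degree ([:- c, 1:] * q) \<le> degree [:- c, 1:] + degree q" by (rule degree_mult_le)
    then show ?thesis by (simp add: n_def)
  qed
  have "poly_act ([:- c, 1:] * q) B x
      = (\<Sum>i\<le>Suc n. coeff (pCons 0 q) i *s (((*v) B) ^^ i) x)
        - (\<Sum>i\<le>Suc n. (c * coeff q i) *s (((*v) B) ^^ i) x)"
    unfolding poly_act_bound[OF deg] unfolding *
    by (simp only: coeff_diff coeff_smult vector_sub_rdistrib sum_subtractf)
  also have "(\<Sum>i\<le>Suc n. coeff (pCons 0 q) i *s (((*v) B) ^^ i) x)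
      = (\<Sum>i\<le>n. coeff q i *s (((*v) B) ^^ i) (B *v x))"
    by (subst sum.atMost_Suc_shift) (simp add: matrix_power_step)
  also have "(\<Sum>i\<le>Suc n. (c * coeff q i) *s (((*v) B) ^^ i) x)
      = (\<Sum>i\<le>n. coeff q i *s (c *s (((*v) B) ^^ i) x))"
    by (simp add: n_def coeff_eq_0 vector_smult_assoc mult.commute)
  finally show ?thesis
    by (simp add: poly_act_def n_def[symmetric] matrix_power_linear vector_ssub_ldistrib sum_subtractf)
qed

lemma poly_act_shift:
  "poly_act q B (B *v x - c *s x) = B *v poly_act q B x - c *s poly_act q B x"
  by (simp add: poly_act_def matrix_power_linear matrix_mult_sum_scaled matrix_power_step
      vector_ssub_ldistrib sum_subtractf vec.scale_sum_right vector_smult_assoc mult.commute)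

text \<open>Split off one root \<open>c\<close> of the annihilating polynomial,
  \<open>q = (X - c) p\<close>. If \<open>p\<close> already annihilates \<open>x\<close>, induct on the degree; otherwise
  \<open>p(B) x\<close> is an eigenvector, so \<open>c\<close> lies in the open unit disc and the iterates of \<open>x\<close> satisfy a
  stable scalar recursion driven by those of \<open>(B - c) x\<close>, which \<open>p\<close> annihilates.\<close>

lemma powers_tendsto_zero_of_annihilator:
  fixes B :: "complex^'n^'n"
  assumes eig: "\<And>c v. v \<noteq> 0 \<Longrightarrow> B *v v = c *s v \<Longrightarrow> cmod c < 1"
  shows "q \<noteq> 0 \<Longrightarrow> poly_act q B x = 0 \<Longrightarrow> (\<lambda>k. (((*v) B) ^^ k) x) \<longlonglongrightarrow> 0"
proof (induction "degree q" arbitrary: q x)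
  case 0
  then have "coeff q 0 *s x = 0" "coeff q 0 \<noteq> 0"
    using leading_coeff_neq_0[of q] by (auto simp: poly_act_def)
  then have "x = 0" by (simp add: vector_mul_eq_0)
  moreover have "(((*v) B) ^^ k) 0 = 0" for k by (induction k) simp_all
  ultimately show ?case by simp
next
  case (Suc d)
  have "\<not> constant (poly q)" using Suc.hyps(2) by (simp add: constant_degree)
  then obtain c where "poly q c = 0" using fundamental_theorem_of_algebra by blast
  then obtain p where p: "q = [:- c, 1:] * p" by (auto simp: poly_eq_0_iff_dvd)
  have p0: "p \<noteq> 0" using Suc.prems(1) p by auto
  have "degree q = degree [:- c, 1:] + degree p"
    unfolding p by (rule degree_mult_eq) (use p0 in auto)
  then have dp: "d = degree p" using Suc.hyps(2) by simp
  have act: "poly_act p B (B *v x - c *s x) = 0"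
    using Suc.prems(2) by (simp only: p poly_act_linear_factor)
  show ?case
  proof (cases "poly_act p B x = 0")
    case True
    then show ?thesis by (rule Suc.hyps(1)[OF dp p0])
  next
    case False
    then have c: "cmod c < 1" using act eig by (simp add: poly_act_shift)
    have lim: "(\<lambda>k. (((*v) B) ^^ k) (B *v x - c *s x)) \<longlonglongrightarrow> 0"
      by (rule Suc.hyps(1)[OF dp p0 act])
    show ?thesis
    proof (rule vec_tendstoI)
      fix i
      have "(\<lambda>k. (((*v) B) ^^ k) x $ i) \<longlonglongrightarrow> 0"
      proof (rule perturbed_geometric_tendsto_zero[OF c])
        show "(\<lambda>k. (((*v) B) ^^ k) (B *v x - c *s x) $ i) \<longlonglongrightarrow> 0"
          using tendsto_vec_nth[OF lim, of i] by simp
        fix k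
        show "(((*v) B) ^^ Suc k) x $ i
            = c * (((*v) B) ^^ k) x $ i + (((*v) B) ^^ k) (B *v x - c *s x) $ i"
          by (simp add: matrix_power_linear matrix_power_step)
      qed
      then show "(\<lambda>k. (((*v) B) ^^ k) x $ i) \<longlonglongrightarrow> 0 $ i" by simp
    qed
  qed
qed

text \<open>The first \<open>N + 1\<close> iterates of \<open>x\<close> are dependent over the reals, where \<open>N\<close> is the real dimension;
  if two of them coincide they give a relation on their own.\<close>

lemma annihilating_polynomial:
  fixes B :: "complex^'n^'n"
  obtains q where "q \<noteq> 0" "poly_act q B x = 0"
proof -
  define v where "v i = (((*v) B) ^^ i) x" for i
  define N where "N = DIM(complex^'n)"
  have "\<exists>a :: nat \<Rightarrow> real. (\<exists>i\<le>N. a i \<noteq> 0) \<and> (\<Sum>i\<le>N. a i *\<^sub>R v i) = 0"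
  proof (cases "inj_on v {..N}")
    case True
    then have "DIM(complex^'n) < card (v ` {..N})" by (simp add: card_image N_def)
    then have "dependent (v ` {..N})" using dependent_biggerset by blast
    then obtain u where u: "\<exists>y\<in>v ` {..N}. u y \<noteq> 0" "(\<Sum>y\<in>v ` {..N}. u y *\<^sub>R y) = 0"
      using dependent_finite[of "v ` {..N}"] by auto
    then show ?thesis
      by (intro exI[of _ "\<lambda>i. u (v i)"]) (auto simp: sum.reindex[OF True])
  next
    case False
    then obtain i j where ij: "i \<le> N" "j \<le> N" "v i = v j" "i \<noteq> j" by (auto simp: inj_on_def)
    have "(\<Sum>k\<le>N. (of_bool (k = i) - of_bool (k = j)) *\<^sub>R v k)
        = (\<Sum>k\<le>N. if k = i then v k else 0) - (\<Sum>k\<le>N. if k = j then v k else 0)"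
      unfolding sum_subtractf[symmetric] by (rule sum.cong) auto
    also have "\<dots> = 0" using ij by simp
    finally show ?thesis using ij
      by (intro exI[of _ "\<lambda>k. of_bool (k = i) - of_bool (k = j)"]) auto
  qed
  then obtain a :: "nat \<Rightarrow> real" and i0 where a: "i0 \<le> N" "a i0 \<noteq> 0" "(\<Sum>i\<le>N. a i *\<^sub>R v i) = 0" by blast
  define q where "q = (\<Sum>i\<le>N. monom (complex_of_real (a i)) i)"
  have coeff: "coeff q i = (if i \<le> N then of_real (a i) else 0)" for i
    by (simp add: q_def coeff_sum)
  have "degree q \<le> N" by (rule degree_le) (simp add: coeff)
  then have "poly_act q B x = (\<Sum>i\<le>N. complex_of_real (a i) *s v i)"
    by (simp add: poly_act_bound v_def coeff)
  also have "\<dots> = (\<Sum>i\<le>N. a i *\<^sub>R v i)"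
    by (rule sum.cong[OF refl], unfold vec_eq_iff vector_scaleR_component vector_smult_component)
      (simp add: scaleR_conv_of_real)
  finally have "poly_act q B x = 0" using a(3) by simp
  moreover have "q \<noteq> 0" using a(1,2) coeff[of i0] by auto
  ultimately show ?thesis using that by blast
qed

lemma schur_stable_powers_tendsto_zero:
  fixes A :: "real^'n^'n"
  assumes "schur_stable A"
  shows "(\<lambda>k. (((*v) A) ^^ k) x) \<longlonglongrightarrow> 0"
proof -
  let ?B = "map_matrix complex_of_real A"
  let ?c = "\<lambda>x :: real^'n. (\<chi> i. complex_of_real (x $ i))"
  have step: "?B *v ?c y = ?c (A *v y)" for y
    by (simp add: vec_eq_iff matrix_vector_mult_def map_matrix_def)
  have pow: "(((*v) ?B) ^^ k) (?c x) = ?c ((((*v) A) ^^ k) x)" for k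
    by (induction k) (simp_all add: step)
  obtain q where q: "q \<noteq> 0" "poly_act q ?B (?c x) = 0" by (rule annihilating_polynomial)
  have "cmod c < 1" if "v \<noteq> 0" "?B *v v = c *s v" for c v
    using assms that unfolding schur_stable_def by blast
  from powers_tendsto_zero_of_annihilator[OF this q]
  have lim: "(\<lambda>k. ?c ((((*v) A) ^^ k) x)) \<longlonglongrightarrow> 0" by (simp add: pow)
  show ?thesis
  proof (rule vec_tendstoI)
    fix i
    show "(\<lambda>k. (((*v) A) ^^ k) x $ i) \<longlonglongrightarrow> 0 $ i"
      using tendsto_Re[OF tendsto_vec_nth[OF lim, of i]] by simp
  qed
qed

lemma schur_stable_transpose_powers_tendsto_zero:
  fixes A :: "real^'n^'n"
  assumes "schur_stable A"
  shows "(\<lambda>k. (((*v) (transpose A)) ^^ k) x) \<longlonglongrightarrow> 0"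
proof (rule vec_tendstoI)
  fix i
  have adj: "(((*v) (transpose A)) ^^ k) x \<bullet> y = x \<bullet> (((*v) A) ^^ k) y" for k y
  proof (induction k arbitrary: y)
    case (Suc k)
    have "(((*v) (transpose A)) ^^ Suc k) x \<bullet> y = (((*v) (transpose A)) ^^ k) x \<bullet> (A *v y)"
      by (simp only: funpow.simps comp_def inner_transpose)
    also have "\<dots> = x \<bullet> (((*v) A) ^^ k) (A *v y)" by (rule Suc.IH)
    finally show ?case
      using funpow_swap1[of "(*v) A" k y] by (simp only: funpow.simps comp_def)
  qed simp
  have "(\<lambda>k. x \<bullet> (((*v) A) ^^ k) (axis i 1)) \<longlonglongrightarrow> x \<bullet> 0"
    by (intro tendsto_inner tendsto_const schur_stable_powers_tendsto_zero assms)
  then show "(\<lambda>k. (((*v) (transpose A)) ^^ k) x $ i) \<longlonglongrightarrow> 0 $ i"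
    unfolding adj[symmetric] by (simp add: inner_axis)
qed

text \<open>Symmetry and definiteness both come from following a bilinear form along the
  iterates of \<open>A\<^sup>T\<close>: for the antisymmetric part it is constant, for \<open>X\<close> itself it decreases, and in
  both cases it tends to 0.\<close>

lemma lyapunov_solution_psd:
  fixes A X W :: "real^'n^'n"
  assumes A: "schur_stable A" and X: "X = A ** X ** transpose A + W" and W: "psd W"
  shows "psd X"
proof -
  define y where "y k x = (((*v) (transpose A)) ^^ k) x" for k x
  have y0: "y 0 x = x" and ySuc: "y (Suc k) x = transpose A *v y k x" for k x
    by (simp_all only: y_def funpow.simps comp_def id_apply)
  have lim: "(\<lambda>k. y k u \<bullet> (Z *v y k x)) \<longlonglongrightarrow> 0" for Z :: "real^'n^'n" and u x
  proof -
    have "(\<lambda>k. y k u \<bullet> (Z *v y k x)) \<longlonglongrightarrow> 0 \<bullet> (Z *v 0)"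
      unfolding y_def
      by (intro tendsto_inner bounded_linear.tendsto[OF matrix_vector_mul_bounded_linear]
          schur_stable_transpose_powers_tendsto_zero A)
    then show ?thesis by simp
  qed
  have form: "u \<bullet> ((A ** Z ** transpose A) *v x) = (transpose A *v u) \<bullet> (Z *v (transpose A *v x))"
    for Z :: "real^'n^'n" and u x
    by (simp only: inner_transpose matrix_vector_mul_assoc matrix_mul_assoc)
  have sym: "transpose X = X"
  proof -
    define Z where "Z = X - transpose X"
    have Xt: "transpose X = A ** transpose X ** transpose A + W"
      using W by (subst X) (simp add: transpose_linear matrix_transpose_mul psd_def matrix_mul_assoc)
    have "Z = (A ** X ** transpose A + W) - (A ** transpose X ** transpose A + W)"
      unfolding Z_def by (rule arg_cong2[where f = "(-)", OF X Xt])
    also have "\<dots> = A ** Z ** transpose A"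
      by (simp add: Z_def matrix_ring)
    finally have Z: "Z = A ** Z ** transpose A" .
    have "u \<bullet> (Z *v x) = y k u \<bullet> (Z *v y k x)" for u x k
    proof (induction k)
      case (Suc k)
      have "y k u \<bullet> (Z *v y k x) = y (Suc k) u \<bullet> (Z *v y (Suc k) x)"
        by (subst Z) (simp only: form ySuc)
      with Suc show ?case by simp
    qed (simp add: y0)
    then have "u \<bullet> (Z *v x) = 0" for u x
      using lim[of u Z x] by (simp add: LIMSEQ_const_iff)
    then have "Z *v x = 0" for x by (metis inner_eq_zero_iff)
    then have "Z = 0" by (simp add: matrix_eq)
    then show ?thesis by (simp add: Z_def)
  qed
  have "0 \<le> x \<bullet> (X *v x)" for x
  proof -
    have step: "y (Suc k) x \<bullet> (X *v y (Suc k) x) \<le> y k x \<bullet> (X *v y k x)" for k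
    proof -
      have "y k x \<bullet> (X *v y k x) = y k x \<bullet> ((A ** X ** transpose A + W) *v y k x)"
        using X by simp
      then show ?thesis using W
        by (simp only: matrix_vector_mult_add_rdistrib inner_add_right form ySuc psd_def)
          (simp add: le_add_same_cancel1)
    qed
    have "y k x \<bullet> (X *v y k x) \<le> x \<bullet> (X *v x)" for k
      by (induction k) (simp add: y0, use step order_trans in blast)
    then show ?thesis by (intro LIMSEQ_le_const2[OF lim[of x X x]]) auto
  qed
  with sym show ?thesis by (simp add: psd_def)
qed

section \<open>The error covariance after a linear measurement\<close>

text \<open>Covariance of a quantity with prior covariance \<open>Y\<close> after it has been measured directly with noise
  covariance \<open>\<Sigma>\<close>.\<close>

definition filtered_cov :: "real^'n^'n \<Rightarrow> real^'n^'n \<Rightarrow> real^'n^'n" where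
  "filtered_cov \<Sigma> Y = Y - Y ** matrix_inv (Y + \<Sigma>) ** Y"

text \<open>The same measurement processed with an arbitrary gain \<open>K\<close> (Joseph form). It is affine in \<open>Y\<close>, and
  \<open>filtered_cov\<close> is its minimum over \<open>K\<close>; order properties of the nonlinear map are read off from
  this representation.\<close>

definition gain_cov :: "real^'n^'n \<Rightarrow> real^'n^'n \<Rightarrow> real^'n^'n \<Rightarrow> real^'n^'n" where
  "gain_cov \<Sigma> Y K = (mat 1 - K) ** Y ** transpose (mat 1 - K) + K ** \<Sigma> ** transpose K"

lemma gain_cov_completed_square:
  fixes Y \<Sigma> K :: "real^'n^'n"
  assumes Y: "transpose Y = Y" and \<Sigma>: "transpose \<Sigma> = \<Sigma>" and inv: "invertible (Y + \<Sigma>)"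
  shows "gain_cov \<Sigma> Y K = filtered_cov \<Sigma> Y
    + (K - Y ** matrix_inv (Y + \<Sigma>)) ** (Y + \<Sigma>) ** transpose (K - Y ** matrix_inv (Y + \<Sigma>))"
proof -
  let ?N = "Y + \<Sigma>" and ?I = "matrix_inv (Y + \<Sigma>)"
  have I: "transpose ?I = ?I" using matrix_inv_symmetric[OF inv] by (simp add: transpose_linear Y \<Sigma>)
  have "(K - Y ** ?I) ** ?N = K ** ?N - Y"
    by (simp add: matrix_diff_rdistrib matrix_mul_assoc[symmetric] matrix_inv_left[OF inv])
  moreover have "transpose (K - Y ** ?I) = transpose K - ?I ** Y"
    by (simp add: transpose_linear matrix_transpose_mul I Y)
  moreover have "(K ** ?N - Y) ** (transpose K - ?I ** Y)
      = K ** ?N ** transpose K - K ** (?N ** ?I) ** Y - Y ** transpose K + Y ** ?I ** Y"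
    by (simp only: matrix_diff_ldistrib matrix_diff_rdistrib matrix_mul_assoc) simp
  ultimately have "(K - Y ** ?I) ** ?N ** transpose (K - Y ** ?I)
      = K ** ?N ** transpose K - K ** Y - Y ** transpose K + Y ** ?I ** Y"
    by (simp add: matrix_inv_right[OF inv])
  then show ?thesis
    by (simp add: gain_cov_def filtered_cov_def transpose_linear matrix_ring transpose_mat algebra_simps)
qed

lemma filtered_cov_le_gain_cov:
  assumes "psd Y" "psd \<Sigma>" "invertible (Y + \<Sigma>)"
  shows "psd (gain_cov \<Sigma> Y K - filtered_cov \<Sigma> Y)"
  using gain_cov_completed_square[of Y \<Sigma> K] psd_congruence[OF psd_add[OF assms(1,2)]] assms
  by (simp add: psd_def)

lemma filtered_cov_eq_gain_cov:
  assumes "psd Y" "psd \<Sigma>" "invertible (Y + \<Sigma>)"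
  shows "filtered_cov \<Sigma> Y = gain_cov \<Sigma> Y (Y ** matrix_inv (Y + \<Sigma>))"
  using gain_cov_completed_square[of Y \<Sigma> "Y ** matrix_inv (Y + \<Sigma>)"] assms
  by (simp add: psd_def matrix_mult_zero)

lemma psd_filtered_cov:
  assumes "psd Y" "psd \<Sigma>" "invertible (Y + \<Sigma>)"
  shows "psd (filtered_cov \<Sigma> Y)"
  unfolding filtered_cov_eq_gain_cov[OF assms] gain_cov_def
  by (intro psd_add psd_congruence assms)

text \<open>In general \<open>Z = I - K\<close> for the optimal gain \<open>K\<close> is no contraction in the semidefinite order. Here
  it is one in the direction \<open>\<Theta>\<close>, because the noise is \<open>\<alpha> \<Theta>\<close>: with \<open>N = Y + \<alpha> \<Theta>\<close> and
  \<open>T = \<Theta> N\<^sup>-\<^sup>1 \<Theta>\<close> one has \<open>Z = \<alpha> \<Theta> N\<^sup>-\<^sup>1\<close>, and both \<open>Z \<Theta> Z\<^sup>T \<le> \<alpha> T\<close> (from \<open>\<alpha> \<Theta> \<le> N\<close>) and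
  \<open>\<alpha> T \<le> \<Theta>\<close> (the filtered covariance is semidefinite).\<close>

lemma residual_gain_shrinks:
  fixes Y \<Theta> :: "real^'n^'n"
  assumes Y: "psd Y" and \<Theta>: "psd \<Theta>" and \<alpha>: "0 \<le> \<alpha>" and inv: "invertible (Y + \<alpha> *\<^sub>R \<Theta>)"
  defines "Z \<equiv> mat 1 - Y ** matrix_inv (Y + \<alpha> *\<^sub>R \<Theta>)"
  shows "psd (\<Theta> - Z ** \<Theta> ** transpose Z)"
proof -
  let ?\<Sigma> = "\<alpha> *\<^sub>R \<Theta>"
  let ?N = "Y + ?\<Sigma>" and ?I = "matrix_inv (Y + ?\<Sigma>)"
  have \<Sigma>: "psd ?\<Sigma>" by (rule psd_scaleR[OF \<alpha> \<Theta>])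
  have N: "psd ?N" by (rule psd_add[OF Y \<Sigma>])
  have I: "transpose ?I = ?I" using matrix_inv_symmetric[OF inv] N by (simp add: psd_def)
  have \<Theta>t: "transpose \<Theta> = \<Theta>" using \<Theta> by (simp add: psd_def)
  have Z: "Z = ?\<Sigma> ** ?I"
  proof -
    have "Y ** ?I + ?\<Sigma> ** ?I = mat 1"
      using matrix_inv_right[OF inv] by (simp add: matrix_add_rdistrib)
    then show ?thesis by (simp add: Z_def algebra_simps)
  qed
  show ?thesis
  proof (cases "\<alpha> = 0")
    case True
    then show ?thesis using \<Theta> by (simp add: Z matrix_mult_zero)
  next
    case False
    with \<alpha> have \<alpha>: "0 < \<alpha>" by simp
    let ?T = "\<Theta> ** ?I ** \<Theta>"
    have "?\<Sigma> - \<alpha>\<^sup>2 *\<^sub>R ?T = filtered_cov ?\<Sigma> Y"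
    proof -
      have "Y ** ?I ** Y = (mat 1 - ?\<Sigma> ** ?I) ** Y"
      proof -
        have "Y ** ?I = mat 1 - ?\<Sigma> ** ?I" using Z by (simp add: Z_def algebra_simps)
        then show ?thesis by simp
      qed
      also have "\<dots> = Y - ?\<Sigma> ** ?I ** (?N - ?\<Sigma>)"
        by (simp add: matrix_diff_rdistrib)
      also have "\<dots> = Y - ?\<Sigma> ** (?I ** ?N) + ?\<Sigma> ** ?I ** ?\<Sigma>"
        by (simp only: matrix_diff_ldistrib matrix_mul_assoc) simp
      finally have eq: "Y ** ?I ** Y = Y - ?\<Sigma> ** (?I ** ?N) + ?\<Sigma> ** ?I ** ?\<Sigma>" .
      show ?thesis
        unfolding filtered_cov_def eq matrix_inv_left[OF inv]
        by (simp add: matrix_scaleR_left matrix_scaleR_right power2_eq_square)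
    qed
    then have "psd (?\<Sigma> - \<alpha>\<^sup>2 *\<^sub>R ?T)" using psd_filtered_cov[OF Y \<Sigma> inv] by simp
    from psd_scaleR[OF _ this, of "1 / \<alpha>"] have 1: "psd (\<Theta> - \<alpha> *\<^sub>R ?T)"
      using \<alpha> by (simp add: scaleR_diff_right power2_eq_square)
    have "psd (Z ** Y ** transpose Z)" by (rule psd_congruence[OF Y])
    moreover have "Z ** Y ** transpose Z = \<alpha>\<^sup>2 *\<^sub>R ?T - \<alpha> *\<^sub>R (Z ** \<Theta> ** transpose Z)"
    proof -
      have Zt: "transpose Z = ?I ** ?\<Sigma>" by (simp add: Z matrix_transpose_mul transpose_linear I \<Theta>t)
      have "Z ** ?N ** transpose Z = ?\<Sigma> ** (?I ** ?N) ** (?I ** ?\<Sigma>)"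
        by (simp only: Z Zt[unfolded Z] matrix_mul_assoc)
      also have "\<dots> = \<alpha>\<^sup>2 *\<^sub>R ?T"
        unfolding matrix_inv_left[OF inv] by (simp add: matrix_ring power2_eq_square)
      finally have ZN: "Z ** ?N ** transpose Z = \<alpha>\<^sup>2 *\<^sub>R ?T" .
      have "Z ** ?N ** transpose Z = Z ** Y ** transpose Z + \<alpha> *\<^sub>R (Z ** \<Theta> ** transpose Z)"
        by (simp add: matrix_ring)
      with ZN show ?thesis by (simp add: eq_diff_eq)
    qed
    ultimately have "psd (\<alpha>\<^sup>2 *\<^sub>R ?T - \<alpha> *\<^sub>R (Z ** \<Theta> ** transpose Z))" by simp
    from psd_scaleR[OF _ this, of "1 / \<alpha>"] have 2: "psd (\<alpha> *\<^sub>R ?T - Z ** \<Theta> ** transpose Z)"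
      using \<alpha> by (simp add: scaleR_diff_right power2_eq_square)
    from psd_le_trans[OF 2 1] show ?thesis .
  qed
qed

text \<open>Keep the gain that is optimal for \<open>Y2\<close>. It is suboptimal for \<open>Y1\<close>, and with a fixed gain the update
  is affine, so the perturbation \<open>s \<Theta>\<close> is only multiplied by the residual gain.\<close>

lemma filtered_cov_nonexpansive:
  fixes Y1 Y2 \<Theta> :: "real^'n^'n"
  assumes Y: "psd Y1" "psd Y2" and \<Theta>: "psd \<Theta>" and \<alpha>: "0 \<le> \<alpha>" and s: "0 \<le> s"
    and inv: "invertible (Y1 + \<alpha> *\<^sub>R \<Theta>)" "invertible (Y2 + \<alpha> *\<^sub>R \<Theta>)"
    and le: "psd (Y2 + s *\<^sub>R \<Theta> - Y1)"
  shows "psd (filtered_cov (\<alpha> *\<^sub>R \<Theta>) Y2 + s *\<^sub>R \<Theta> - filtered_cov (\<alpha> *\<^sub>R \<Theta>) Y1)"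
proof -
  let ?\<Sigma> = "\<alpha> *\<^sub>R \<Theta>"
  have \<Sigma>: "psd ?\<Sigma>" by (rule psd_scaleR[OF \<alpha> \<Theta>])
  define K where "K = Y2 ** matrix_inv (Y2 + ?\<Sigma>)"
  define Z where "Z = mat 1 - K"
  have 1: "psd (gain_cov ?\<Sigma> Y1 K - filtered_cov ?\<Sigma> Y1)"
    by (rule filtered_cov_le_gain_cov[OF Y(1) \<Sigma> inv(1)])
  have "psd (Z ** (Y2 + s *\<^sub>R \<Theta> - Y1) ** transpose Z)" by (rule psd_congruence[OF le])
  also have "Z ** (Y2 + s *\<^sub>R \<Theta> - Y1) ** transpose Z
      = filtered_cov ?\<Sigma> Y2 + s *\<^sub>R (Z ** \<Theta> ** transpose Z) - gain_cov ?\<Sigma> Y1 K"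
    unfolding filtered_cov_eq_gain_cov[OF Y(2) \<Sigma> inv(2)] K_def[symmetric]
    by (simp add: gain_cov_def Z_def[symmetric] matrix_ring algebra_simps)
  finally have 2: "psd (filtered_cov ?\<Sigma> Y2 + s *\<^sub>R (Z ** \<Theta> ** transpose Z) - gain_cov ?\<Sigma> Y1 K)" .
  have "psd (s *\<^sub>R (\<Theta> - Z ** \<Theta> ** transpose Z))"
    unfolding Z_def K_def by (intro psd_scaleR s residual_gain_shrinks Y \<Theta> \<alpha> inv)
  then have 3: "psd ((filtered_cov ?\<Sigma> Y2 + s *\<^sub>R \<Theta>)
      - (filtered_cov ?\<Sigma> Y2 + s *\<^sub>R (Z ** \<Theta> ** transpose Z)))"
    by (simp add: algebra_simps)
  from psd_le_trans[OF psd_le_trans[OF 1 2] 3] show ?thesis by (simp add: algebra_simps)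
qed


section \<open>The Riccati operator on the state space\<close>

lemma sum_plus_UNIV: "(\<Sum>i\<in>(UNIV :: ('a::finite + 'b::finite) set). f i)
    = (\<Sum>i\<in>UNIV. f (Inl i)) + (\<Sum>i\<in>UNIV. f (Inr i))" for f :: "_ \<Rightarrow> real"
  unfolding UNIV_Plus_UNIV[symmetric] by (subst sum.Plus) simp_all

lemma hcat_times_vcat: "hcat M N ** vcat X Y = M ** X + N ** Y"
  by (simp add: vec_eq_iff matrix_matrix_mult_def hcat_def vcat_def sum_plus_UNIV)

lemma vcat_times: "vcat M N ** X = vcat (M ** X) (N ** X)"
  by (simp add: vec_eq_iff matrix_matrix_mult_def vcat_def split: sum.split)

lemma times_hcat: "X ** hcat M N = hcat (X ** M) (X ** N)"
  by (simp add: vec_eq_iff matrix_matrix_mult_def hcat_def split: sum.split)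

lemma transpose_hcat: "transpose (hcat M N) = vcat (transpose M) (transpose N)"
  by (simp add: vec_eq_iff transpose_def hcat_def vcat_def split: sum.split)

lemma transpose_vcat: "transpose (vcat M N) = hcat (transpose M) (transpose N)"
  by (simp add: vec_eq_iff transpose_def hcat_def vcat_def split: sum.split)

lemma hcat_vcat: "hcat (vcat M N) (vcat X Y) = vcat (hcat M X) (hcat N Y)"
  by (simp add: vec_eq_iff hcat_def vcat_def split: sum.split)

lemma cat_linear:
  "vcat M N + vcat M' N' = vcat (M + M') (N + N')"
  "hcat X Y + hcat X' Y' = hcat (X + X') (Y + Y')"
  "vcat M N - vcat M' N' = vcat (M - M') (N - N')"
  "hcat X Y - hcat X' Y' = hcat (X - X') (Y - Y')"
  "r *\<^sub>R vcat M N = vcat (r *\<^sub>R M) (r *\<^sub>R N)"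
  "r *\<^sub>R hcat X Y = hcat (r *\<^sub>R X) (r *\<^sub>R Y)"
  by (simp_all add: vec_eq_iff hcat_def vcat_def split: sum.split)

lemmas cat_ring = block_def hcat_times_vcat vcat_times times_hcat transpose_hcat transpose_vcat cat_linear

lemma upper_left_embed: "upper_left (embed Ps P) = P"
  by (simp add: upper_left_def embed_def block_def vcat_def hcat_def vec_eq_iff)

text \<open>The state is \<open>diag(Ps, 0)\<close> plus \<open>D\<close> repeated in all four blocks. The second part is mapped by \<open>A\<close>
  alone, since the block rows of \<open>AA\<close> have the common sum \<open>A\<close>; the first part and the
  noise contribute \<open>A W A\<^sup>T\<close> to all four blocks, by \<open>Kf (C Ps C\<^sup>T + \<Sigma>v) = Ps C\<^sup>T\<close>, and \<open>Ps\<close> to the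
  upper-left one, by the Riccati equation. The correction terms have
  equal block rows for the same reason, so the image lies in the state space again.\<close>

lemma
  fixes A \<Sigma>w Ps \<Sigma>qx \<Sigma>qe D :: "real^'n^'n"
    and C :: "real^'n^'m" and \<Sigma>v :: "real^'m^'m" and Kf Ks :: "real^'m^'n"
    and \<nu> :: real
  assumes Ps: "transpose Ps = Ps" and D: "transpose D = D"
    and inv: "invertible (C ** Ps ** transpose C + \<Sigma>v)"
    and \<Sigma>v: "transpose \<Sigma>v = \<Sigma>v"
    and are: "Ps = A ** Ps ** transpose A + \<Sigma>w
              - A ** Ps ** transpose C ** matrix_inv (C ** Ps ** transpose C + \<Sigma>v)
                ** C ** Ps ** transpose A"
    and Kf: "Kf = Ps ** transpose C ** matrix_inv (C ** Ps ** transpose C + \<Sigma>v)"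
    and Ks: "Ks = A ** Kf"
    and AA: "AA = block A 0 (Ks ** C) (A - Ks ** C)"
    and CC: "CC = (\<lambda>\<nu>. hcat (Kf ** C) (\<nu> *\<^sub>R mat 1 - Kf ** C))"
    and Q: "Q = block \<Sigma>w 0 0 (Ks ** \<Sigma>v ** transpose Ks)"
    and S: "S = vcat 0 (Ks ** \<Sigma>v ** transpose Kf)"
    and R: "R = (\<lambda>\<nu>. Kf ** \<Sigma>v ** transpose Kf + \<nu>\<^sup>2 *\<^sub>R \<Sigma>qx + (1 - \<nu>)\<^sup>2 *\<^sub>R \<Sigma>qe)"
  defines "W \<equiv> Kf ** (C ** Ps ** transpose C + \<Sigma>v) ** transpose Kf"
  defines "N \<equiv> W + \<nu>\<^sup>2 *\<^sub>R (D + \<Sigma>qx) + (1 - \<nu>)\<^sup>2 *\<^sub>R \<Sigma>qe"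
  defines "G \<equiv> W + \<nu> *\<^sub>R D"
  shows innovation_cov_embed: "innovation_cov CC R (embed Ps (Ps + D)) \<nu> = N"
    and riccati_embed: "riccati AA CC Q S R (embed Ps (Ps + D)) g \<nu>
      = embed Ps (Ps + A ** (D + W - g *\<^sub>R (G ** matrix_inv N ** G)) ** transpose A)"
proof -
  let ?M = "C ** Ps ** transpose C + \<Sigma>v"
  let ?E = "embed Ps (Ps + D)"
  have M: "transpose ?M = ?M"
    by (simp add: transpose_linear matrix_transpose_mul Ps \<Sigma>v matrix_mul_assoc)
  have KM: "Kf ** ?M = Ps ** transpose C"
    using matrix_mul_assoc[of "Ps ** transpose C" "matrix_inv ?M" ?M]
    by (simp only: Kf matrix_inv_left[OF inv] matrix_mul_rid)
  have Kv: "Kf ** \<Sigma>v = Ps ** transpose C - Kf ** C ** Ps ** transpose C"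
    using KM by (simp add: matrix_ring algebra_simps)
  have Kt: "transpose Kf = matrix_inv ?M ** C ** Ps"
    using matrix_inv_symmetric[OF inv M]
    by (simp add: Kf matrix_transpose_mul Ps matrix_mul_assoc)
  have W1: "W = Ps ** transpose C ** transpose Kf" by (simp add: W_def KM)
  have W2: "W = Kf ** C ** Ps"
    by (simp only: W1 Kt) (simp add: Kf matrix_mul_assoc)
  have Wt: "transpose W = W"
    by (subst W1) (simp add: W2 matrix_transpose_mul Ps matrix_mul_assoc)
  have Gt: "transpose G = G" by (simp add: G_def transpose_linear Wt D)
  have ricc: "A ** Ps ** transpose A + \<Sigma>w = Ps + A ** W ** transpose A"
    using are by (simp add: W2 Kf matrix_mul_assoc algebra_simps)
  have E: "?E = block (Ps + D) D D D" by (simp add: embed_def)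
  have AE: "AA ** ?E = block (A ** Ps + A ** D) (A ** D) (Ks ** C ** Ps + A ** D) (A ** D)"
    by (simp add: E AA cat_ring matrix_ring)
  have CCt: "transpose (CC \<nu>) = vcat (transpose C ** transpose Kf) (\<nu> *\<^sub>R mat 1 - transpose C ** transpose Kf)"
    by (simp add: CC transpose_hcat transpose_linear matrix_transpose_mul transpose_mat)
  have gain: "AA ** ?E ** transpose (CC \<nu>) + S = vcat (A ** G) (A ** G)"
  proof -
    have "Ks ** C ** Ps ** transpose C ** transpose Kf + Ks ** \<Sigma>v ** transpose Kf = A ** W"
      by (simp add: Ks W_def matrix_ring)
    moreover have "A ** Ps ** transpose C ** transpose Kf = A ** W"
      by (simp add: W1 matrix_mul_assoc)
    ultimately show ?thesis
      unfolding AE CCt S G_def by (simp add: cat_ring matrix_ring algebra_simps)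
  qed
  show N: "innovation_cov CC R ?E \<nu> = N"
  proof -
    have "CC \<nu> ** ?E = hcat (Kf ** C ** Ps + \<nu> *\<^sub>R D) (\<nu> *\<^sub>R D)"
      by (simp add: CC E cat_ring matrix_ring)
    moreover have "Kf ** C ** Ps ** transpose C ** transpose Kf + Kf ** \<Sigma>v ** transpose Kf = W"
      by (simp add: W_def matrix_ring)
    ultimately show ?thesis
      unfolding innovation_cov_def CCt R N_def
      by (simp add: cat_ring matrix_ring power2_eq_square algebra_simps)
  qed
  have free: "AA ** ?E ** transpose AA + Q
      = embed Ps (Ps + A ** (D + W) ** transpose A)"
  proof -
    have AAt: "transpose AA = block (transpose A) (transpose C ** transpose Ks) 0 (transpose A - transpose C ** transpose Ks)"
      by (simp add: AA cat_ring transpose_linear matrix_transpose_mul hcat_vcat)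
    have 1: "A ** Ps ** transpose C ** transpose Ks = A ** W ** transpose A"
      by (simp add: W1 Ks matrix_transpose_mul matrix_mul_assoc)
    have 2: "Ks ** C ** Ps ** transpose A = A ** W ** transpose A"
      by (simp add: W2 Ks matrix_mul_assoc)
    have 3: "Ks ** \<Sigma>v ** transpose Ks
        = A ** W ** transpose A - Ks ** C ** Ps ** transpose C ** transpose Ks"
      by (simp add: W_def Ks matrix_ring matrix_transpose_mul)
    have "AA ** ?E ** transpose AA + Q
        = block (A ** Ps ** transpose A + \<Sigma>w + A ** D ** transpose A)
            (A ** W ** transpose A + A ** D ** transpose A)
            (A ** W ** transpose A + A ** D ** transpose A)
            (A ** W ** transpose A + A ** D ** transpose A)"
      unfolding AE AAt Q
      by (simp add: cat_ring matrix_ring 1 2 3 algebra_simps)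
    then show ?thesis unfolding embed_def ricc by (simp add: matrix_ring algebra_simps)
  qed
  show "riccati AA CC Q S R ?E g \<nu>
      = embed Ps (Ps + A ** (D + W - g *\<^sub>R (G ** matrix_inv N ** G)) ** transpose A)"
    unfolding riccati_def gain N free
    by (simp add: embed_def cat_ring hcat_vcat matrix_ring matrix_transpose_mul Gt algebra_simps)
qed

section \<open>Average cost optimality for contractive decision processes\<close>

text \<open>The argument \<open>r\<close> charges the state reached after the step, as the cost in question does.\<close>

definition cost_to_go ::
  "real \<Rightarrow> ('s \<Rightarrow> real \<Rightarrow> real) \<Rightarrow> ('s \<Rightarrow> real \<Rightarrow> real \<Rightarrow> 's) \<Rightarrow> ('s \<Rightarrow> real) \<Rightarrow> 's \<Rightarrow> real \<Rightarrow> real"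
  where
  "cost_to_go q r F V x v
    = (1 - q) * (r (F x 0 v) v + V (F x 0 v)) + q * (r (F x 1 v) v + V (F x 1 v))"

text \<open>\<open>le s x y\<close> stands for \<open>x \<le> y + s \<Theta>\<close>: an order relation with a numerical defect \<open>s\<close>, which every
  transition reduces by the factor \<open>\<kappa>\<close>. The state \<open>x0\<close> is a least element from which every other state
  is at finite distance.\<close>

locale contractive_decision_process =
  fixes X :: "'s set" and x0 :: 's and F :: "'s \<Rightarrow> real \<Rightarrow> real \<Rightarrow> 's"
    and r :: "'s \<Rightarrow> real \<Rightarrow> real" and q :: real
    and le :: "real \<Rightarrow> 's \<Rightarrow> 's \<Rightarrow> bool" and \<kappa> l b :: real
  assumes x0: "x0 \<in> X"
    and F_closed: "\<And>x g v. x \<in> X \<Longrightarrow> g \<in> {0, 1} \<Longrightarrow> v \<in> {0, 1} \<Longrightarrow> F x g v \<in> X"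
    and q: "0 \<le> q" "q \<le> 1"
    and \<kappa>: "0 \<le> \<kappa>" "\<kappa> < 1"
    and l: "0 \<le> l"
    and b: "0 \<le> b"
    and r_nonneg: "\<And>x v. x \<in> X \<Longrightarrow> v \<in> {0, 1} \<Longrightarrow> 0 \<le> r x v"
    and r_mono: "\<And>s x y v. 0 \<le> s \<Longrightarrow> x \<in> X \<Longrightarrow> y \<in> X \<Longrightarrow> v \<in> {0, 1} \<Longrightarrow> le s x y
        \<Longrightarrow> r x v \<le> r y v + l * s"
    and F_contr: "\<And>s x y g v. 0 \<le> s \<Longrightarrow> x \<in> X \<Longrightarrow> y \<in> X \<Longrightarrow> g \<in> {0, 1} \<Longrightarrow> v \<in> {0, 1}
        \<Longrightarrow> le s x y \<Longrightarrow> le (\<kappa> * s) (F x g v) (F y g v)"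
    and x0_least: "\<And>x. x \<in> X \<Longrightarrow> le 0 x0 x"
    and x0_reach: "\<And>x. x \<in> X \<Longrightarrow> \<exists>s\<ge>0. le s x x0"
    and x0_step: "\<And>g v. g \<in> {0, 1} \<Longrightarrow> v \<in> {0, 1} \<Longrightarrow> le b (F x0 g v) x0"
    and le_trans: "\<And>s t x y z. le s x y \<Longrightarrow> le t y z \<Longrightarrow> le (s + t) x z"
begin

abbreviation action_value :: "real \<Rightarrow> ('s \<Rightarrow> real) \<Rightarrow> 's \<Rightarrow> real \<Rightarrow> real" where
  "action_value \<alpha> V \<equiv> cost_to_go q r F (\<lambda>y. \<alpha> * V y)"

definition bellman :: "real \<Rightarrow> ('s \<Rightarrow> real) \<Rightarrow> 's \<Rightarrow> real" where
  "bellman \<alpha> V x = min (action_value \<alpha> V x 0) (action_value \<alpha> V x 1)"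

text \<open>The geometric series of the defects \<open>\<kappa> s, \<kappa>\<^sup>2 s, \<dots>\<close> of two coupled trajectories, each weighted by the
  slope \<open>l\<close> of the stage cost.\<close>

definition slope :: real where "slope = l * \<kappa> / (1 - \<kappa>)"

lemma slope_nonneg: "0 \<le> slope" using \<kappa> l by (simp add: slope_def)

lemma slope_fixed: "l * \<kappa> + slope * \<kappa> = slope"
  using \<kappa> by (simp add: slope_def field_simps)

definition slope_bounded :: "('s \<Rightarrow> real) \<Rightarrow> bool" where
  "slope_bounded V \<longleftrightarrow> (\<forall>s x y. 0 \<le> s \<longrightarrow> x \<in> X \<longrightarrow> y \<in> X \<longrightarrow> le s x y \<longrightarrow> V x \<le> V y + slope * s)"

text \<open>The two states are coupled by giving them the same decision and the same reception. The constant
  \<open>slope\<close> is the fixed point of the resulting recursion, which makes the bound independent of \<open>\<alpha>\<close>.\<close>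

lemma bellman_slope_bounded:
  assumes V: "slope_bounded V" and \<alpha>: "0 \<le> \<alpha>" "\<alpha> \<le> 1"
  shows "slope_bounded (bellman \<alpha> V)"
  unfolding slope_bounded_def
proof (intro allI impI)
  fix s x y assume s: "0 \<le> s" and x: "x \<in> X" and y: "y \<in> X" and le: "le s x y"
  have step: "r (F x g v) v + \<alpha> * V (F x g v) \<le> r (F y g v) v + \<alpha> * V (F y g v) + slope * s"
    if g: "g \<in> {0, 1}" and v: "v \<in> {0, 1}" for g v
  proof -
    have c: "le (\<kappa> * s) (F x g v) (F y g v)" by (rule F_contr[OF s x y g v le])
    have ks: "0 \<le> \<kappa> * s" using \<kappa> s by simp
    have 1: "r (F x g v) v \<le> r (F y g v) v + l * (\<kappa> * s)"
      by (rule r_mono[OF ks F_closed F_closed v c]) (use x y g v in auto)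
    have "V (F x g v) \<le> V (F y g v) + slope * (\<kappa> * s)"
      using V ks c F_closed[OF x g v] F_closed[OF y g v] unfolding slope_bounded_def by blast
    then have "\<alpha> * V (F x g v) \<le> \<alpha> * (V (F y g v) + slope * (\<kappa> * s))"
      by (rule mult_left_mono[OF _ \<alpha>(1)])
    also have "\<dots> \<le> \<alpha> * V (F y g v) + slope * (\<kappa> * s)"
      using \<alpha> slope_nonneg ks by (simp add: distrib_left mult_left_le_one_le)
    finally have "r (F x g v) v + \<alpha> * V (F x g v)
        \<le> r (F y g v) v + \<alpha> * V (F y g v) + (l * \<kappa> + slope * \<kappa>) * s"
      using 1 by (simp add: algebra_simps)
    then show ?thesis by (simp only: slope_fixed)
  qed
  have av: "action_value \<alpha> V x v \<le> action_value \<alpha> V y v + slope * s" if v: "v \<in> {0, 1}" for v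
  proof -
    have "action_value \<alpha> V x v
        \<le> (1 - q) * (r (F y 0 v) v + \<alpha> * V (F y 0 v) + slope * s)
          + q * (r (F y 1 v) v + \<alpha> * V (F y 1 v) + slope * s)"
      unfolding cost_to_go_def by (intro add_mono mult_left_mono step v) (use q in auto)
    also have "\<dots> = action_value \<alpha> V y v + slope * s" by (simp add: cost_to_go_def algebra_simps)
    finally show ?thesis .
  qed
  show "bellman \<alpha> V x \<le> bellman \<alpha> V y + slope * s"
    using av[of 0] av[of 1] by (simp add: bellman_def min_def)
qed

lemma bellman_mono:
  assumes "\<And>x. x \<in> X \<Longrightarrow> V x \<le> V' x" "0 \<le> \<alpha>" "x \<in> X"
  shows "bellman \<alpha> V x \<le> bellman \<alpha> V' x"
  unfolding bellman_def cost_to_go_def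
  by (intro min.mono add_mono mult_left_mono order_refl assms F_closed) (use q in auto)

lemma bellman_nonneg:
  assumes "\<And>x. x \<in> X \<Longrightarrow> 0 \<le> V x" "0 \<le> \<alpha>" "x \<in> X"
  shows "0 \<le> bellman \<alpha> V x"
  unfolding bellman_def cost_to_go_def
  by (intro min.boundedI add_nonneg_nonneg mult_nonneg_nonneg r_nonneg assms F_closed) (use q in auto)

primrec iterate :: "real \<Rightarrow> nat \<Rightarrow> 's \<Rightarrow> real" where
  "iterate \<alpha> 0 = (\<lambda>_. 0)"
| "iterate \<alpha> (Suc n) = bellman \<alpha> (iterate \<alpha> n)"

lemma iterate_slope_bounded: "0 \<le> \<alpha> \<Longrightarrow> \<alpha> \<le> 1 \<Longrightarrow> slope_bounded (iterate \<alpha> n)"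
proof (induction n)
  case 0 then show ?case using slope_nonneg by (simp add: slope_bounded_def)
qed (simp add: bellman_slope_bounded)

lemma iterate_nonneg: "0 \<le> \<alpha> \<Longrightarrow> x \<in> X \<Longrightarrow> 0 \<le> iterate \<alpha> n x"
  by (induction n arbitrary: x) (simp_all add: bellman_nonneg)

lemma iterate_incseq: "0 \<le> \<alpha> \<Longrightarrow> x \<in> X \<Longrightarrow> iterate \<alpha> n x \<le> iterate \<alpha> (Suc n) x"
proof (induction n arbitrary: x)
  case 0 then show ?case using iterate_nonneg[of \<alpha> x 1] by simp
next
  case (Suc n)
  show ?case
    unfolding iterate.simps(2)[of \<alpha> "Suc n"] iterate.simps(2)[of \<alpha> n]
    by (rule bellman_mono) (use Suc in auto)
qed

definition base_cost :: real where
  "base_cost = (1 - q) * r (F x0 0 0) 0 + q * r (F x0 1 0) 0"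

lemma bellman_x0_le:
  assumes V: "slope_bounded V" and \<alpha>: "0 \<le> \<alpha>" "\<alpha> \<le> 1"
  shows "bellman \<alpha> V x0 \<le> base_cost + slope * b + \<alpha> * V x0"
proof -
  have step: "\<alpha> * V (F x0 g 0) \<le> \<alpha> * V x0 + slope * b" if "g \<in> {0, 1}" for g
  proof -
    have "V (F x0 g 0) \<le> V x0 + slope * b"
      using V b x0 x0_step[OF that, of 0] F_closed[OF x0 that, of 0] unfolding slope_bounded_def by blast
    then have "\<alpha> * V (F x0 g 0) \<le> \<alpha> * (V x0 + slope * b)"
      by (rule mult_left_mono[OF _ \<alpha>(1)])
    also have "\<dots> \<le> \<alpha> * V x0 + slope * b"
      using \<alpha> slope_nonneg b by (simp add: distrib_left mult_left_le_one_le)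
    finally show ?thesis .
  qed
  have "bellman \<alpha> V x0 \<le> action_value \<alpha> V x0 0" by (simp add: bellman_def)
  also have "\<dots> \<le> (1 - q) * (r (F x0 0 0) 0 + (\<alpha> * V x0 + slope * b))
      + q * (r (F x0 1 0) 0 + (\<alpha> * V x0 + slope * b))"
    unfolding cost_to_go_def by (intro add_mono mult_left_mono order_refl step) (use q in auto)
  also have "\<dots> = base_cost + slope * b + \<alpha> * V x0" by (simp add: base_cost_def algebra_simps)
  finally show ?thesis .
qed

text \<open>One step from \<open>x0\<close> leads to a state whose value differs from that of \<open>x0\<close> by at most \<open>slope * b\<close>, so
  the values at \<open>x0\<close> obey a scalar recursion.\<close>

lemma iterate_x0_bound:
  assumes \<alpha>: "0 \<le> \<alpha>" "\<alpha> < 1"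
  shows "iterate \<alpha> n x0 \<le> (base_cost + slope * b) / (1 - \<alpha>)"
proof (induction n)
  case 0
  have "0 \<le> base_cost"
    unfolding base_cost_def using q by (intro add_nonneg_nonneg mult_nonneg_nonneg r_nonneg F_closed x0) auto
  then show ?case using \<alpha> slope_nonneg b by simp
next
  case (Suc n)
  have "iterate \<alpha> (Suc n) x0 \<le> base_cost + slope * b + \<alpha> * iterate \<alpha> n x0"
    using bellman_x0_le[OF iterate_slope_bounded] \<alpha> by simp
  also have "\<dots> \<le> base_cost + slope * b + \<alpha> * ((base_cost + slope * b) / (1 - \<alpha>))"
    using \<alpha> Suc by (intro add_left_mono mult_left_mono) auto
  also have "\<dots> = (base_cost + slope * b) / (1 - \<alpha>)"
  proof -
    have geometric: "z + \<alpha> * (z / (1 - \<alpha>)) = z / (1 - \<alpha>)" for z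
      using \<alpha> by (simp add: divide_simps) (simp add: algebra_simps)
    show ?thesis by (rule geometric)
  qed
  finally show ?case .
qed

definition discounted_value :: "real \<Rightarrow> 's \<Rightarrow> real" where
  "discounted_value \<alpha> x = lim (\<lambda>n. iterate \<alpha> n x)"

lemma iterate_tendsto:
  assumes \<alpha>: "0 \<le> \<alpha>" "\<alpha> < 1" and x: "x \<in> X"
  shows "(\<lambda>n. iterate \<alpha> n x) \<longlonglongrightarrow> discounted_value \<alpha> x"
proof -
  obtain s where s: "0 \<le> s" "le s x x0" using x0_reach[OF x] by blast
  have "iterate \<alpha> n x \<le> (base_cost + slope * b) / (1 - \<alpha>) + slope * s" for n
  proof -
    have "iterate \<alpha> n x \<le> iterate \<alpha> n x0 + slope * s"
      using iterate_slope_bounded[of \<alpha> n] s x x0 \<alpha> unfolding slope_bounded_def by simp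
    then show ?thesis using iterate_x0_bound[OF \<alpha>, of n] by simp
  qed
  moreover have "incseq (\<lambda>n. iterate \<alpha> n x)"
    using iterate_incseq[OF \<alpha>(1) x] by (intro incseq_SucI)
  ultimately obtain L where "(\<lambda>n. iterate \<alpha> n x) \<longlonglongrightarrow> L"
    using incseq_convergent by blast
  then show ?thesis unfolding discounted_value_def by (simp add: limI)
qed

lemma discounted_value_fixed_point:
  assumes \<alpha>: "0 \<le> \<alpha>" "\<alpha> < 1" and x: "x \<in> X"
  shows "discounted_value \<alpha> x = bellman \<alpha> (discounted_value \<alpha>) x"
proof -
  have "(\<lambda>n. bellman \<alpha> (iterate \<alpha> n) x) \<longlonglongrightarrow> bellman \<alpha> (discounted_value \<alpha>) x"
    unfolding bellman_def cost_to_go_def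
    by (intro tendsto_min tendsto_add tendsto_mult tendsto_const iterate_tendsto F_closed \<alpha> x) auto
  moreover have "(\<lambda>n. bellman \<alpha> (iterate \<alpha> n) x) \<longlonglongrightarrow> discounted_value \<alpha> x"
    using LIMSEQ_Suc[OF iterate_tendsto[OF \<alpha> x]] by simp
  ultimately show ?thesis using LIMSEQ_unique by blast
qed

lemma discounted_value_slope_bounded:
  assumes \<alpha>: "0 \<le> \<alpha>" "\<alpha> < 1"
  shows "slope_bounded (discounted_value \<alpha>)"
  unfolding slope_bounded_def
proof (intro allI impI)
  fix s x y assume s: "0 \<le> s" and x: "x \<in> X" and y: "y \<in> X" and le: "le s x y"
  show "discounted_value \<alpha> x \<le> discounted_value \<alpha> y + slope * s"
  proof (rule LIMSEQ_le)
    show "(\<lambda>n. iterate \<alpha> n x) \<longlonglongrightarrow> discounted_value \<alpha> x" by (rule iterate_tendsto[OF \<alpha> x])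
    show "(\<lambda>n. iterate \<alpha> n y + slope * s) \<longlonglongrightarrow> discounted_value \<alpha> y + slope * s"
      by (intro tendsto_add iterate_tendsto[OF \<alpha> y] tendsto_const)
    show "\<exists>N. \<forall>n\<ge>N. iterate \<alpha> n x \<le> iterate \<alpha> n y + slope * s"
      using iterate_slope_bounded[of \<alpha>] \<alpha> s x y le unfolding slope_bounded_def by simp
  qed
qed

text \<open>The state space may be uncountable, so a convergent subsequence need not exist; a filter finer than
  \<open>sequentially\<close> serves equally well and comes directly from the compactness of a product of intervals.\<close>

lemma pointwise_cluster_point:
  fixes h :: "nat \<Rightarrow> 's \<Rightarrow> real"
  assumes "\<And>n x. h n x \<in> {0..w x}"
  obtains V G where "G \<noteq> bot" "G \<le> sequentially" "\<And>x. ((\<lambda>n. h n x) \<longlongrightarrow> V x) G" "\<And>x. V x \<in> {0..w x}"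
proof -
  let ?U = "Pi\<^sub>E UNIV (\<lambda>x. {0..w x}) :: ('s \<Rightarrow> real) set"
  have "compactin (product_topology (\<lambda>_. euclidean) UNIV) ?U"
    by (subst compactin_PiE) auto
  then have comp: "compact ?U" by (simp add: euclidean_product_topology)
  have "eventually (\<lambda>f. f \<in> ?U) (filtermap h sequentially)"
    using assms by (simp add: eventually_filtermap PiE_def)
  moreover have "filtermap h sequentially \<noteq> bot" by (simp add: filtermap_bot_iff)
  ultimately obtain V where V: "V \<in> ?U" "inf (nhds V) (filtermap h sequentially) \<noteq> bot"
    using comp unfolding compact_filter by blast
  define G where "G = inf (filtercomap h (nhds V)) sequentially"
  have "G \<noteq> bot"
  proof
    assume "G = bot"
    then have "eventually (\<lambda>_. False) G" by simp
    then obtain P P' where P: "eventually P (nhds V)" and P': "eventually P' sequentially"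
      and imp: "\<And>n. P (h n) \<Longrightarrow> P' n \<Longrightarrow> False"
      unfolding G_def eventually_inf eventually_filtercomap by blast
    have "eventually (\<lambda>f. \<not> P f) (filtermap h sequentially)"
      unfolding eventually_filtermap using P' by eventually_elim (use imp in blast)
    then have "eventually (\<lambda>_. False) (inf (nhds V) (filtermap h sequentially))"
      unfolding eventually_inf using P by blast
    then show False using V(2) by (simp add: trivial_limit_def)
  qed
  moreover have "G \<le> sequentially" by (simp add: G_def)
  moreover have "((\<lambda>n. h n x) \<longlongrightarrow> V x) G" for x
  proof -
    have "filterlim h (nhds V) G"
      unfolding filterlim_iff_le_filtercomap G_def by simp
    then show ?thesis
      using continuous_on_tendsto_compose[OF continuous_on_product_coordinates[of x]] by simp
  qed
  moreover have "V x \<in> {0..w x}" for x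
    using PiE_mem[OF V(1), of x] by simp
  ultimately show ?thesis by (rule that)
qed

text \<open>Subtracting \<open>\<alpha> V\<^sub>\<alpha> x0\<close> from the discounted equation gives
  \<open>(1 - \<alpha>) V\<^sub>\<alpha> x0 + h\<^sub>\<alpha> = bellman \<alpha> h\<^sub>\<alpha>\<close> for \<open>h\<^sub>\<alpha> = V\<^sub>\<alpha> - V\<^sub>\<alpha> x0\<close>. The limit of the first term exists
  along the chosen filter because \<open>h\<^sub>\<alpha> x0 = 0\<close> turns it into \<open>bellman \<alpha> h\<^sub>\<alpha> x0\<close>.\<close>

theorem average_cost_optimality_equation:
  obtains \<rho> V where "\<And>x. x \<in> X \<Longrightarrow> \<rho> + V x = bellman 1 V x"
    "\<And>x s. x \<in> X \<Longrightarrow> 0 \<le> s \<Longrightarrow> le s x x0 \<Longrightarrow> 0 \<le> V x \<and> V x \<le> slope * s"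
proof -
  define \<alpha> :: "nat \<Rightarrow> real" where "\<alpha> n = 1 - 1 / real (Suc n)" for n
  have \<alpha>: "0 \<le> \<alpha> n" "\<alpha> n < 1" for n by (simp_all add: \<alpha>_def)
  have \<alpha>_lim: "\<alpha> \<longlonglongrightarrow> 1"
    unfolding \<alpha>_def using tendsto_diff[OF tendsto_const LIMSEQ_inverse_real_of_nat, of 1]
    by (simp add: inverse_eq_divide)
  define h where "h n x = (if x \<in> X then discounted_value (\<alpha> n) x - discounted_value (\<alpha> n) x0 else 0)" for n x
  define w where "w x = (if x \<in> X then slope * (SOME s. 0 \<le> s \<and> le s x x0) else 0)" for x
  have h_bound: "0 \<le> h n x \<and> h n x \<le> slope * s" if "x \<in> X" "0 \<le> s" "le s x x0" for n x s
  proof -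
    have "discounted_value (\<alpha> n) x0 \<le> discounted_value (\<alpha> n) x + slope * 0"
      "discounted_value (\<alpha> n) x \<le> discounted_value (\<alpha> n) x0 + slope * s"
      using discounted_value_slope_bounded[OF \<alpha>, of n] that x0 x0_least[OF that(1)]
      unfolding slope_bounded_def by blast+
    then show ?thesis using that by (simp add: h_def)
  qed
  have hw: "h n x \<in> {0..w x}" for n x
  proof (cases "x \<in> X")
    case True
    then have "\<exists>s. 0 \<le> s \<and> le s x x0" using x0_reach by blast
    then have "0 \<le> (SOME s. 0 \<le> s \<and> le s x x0) \<and> le (SOME s. 0 \<le> s \<and> le s x x0) x x0"
      by (rule someI_ex)
    then show ?thesis
      using h_bound[OF True, of "SOME s. 0 \<le> s \<and> le s x x0" n] True by (simp add: w_def)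
  qed (simp add: h_def w_def)
  obtain V G where G: "G \<noteq> bot" "G \<le> sequentially"
    and V: "\<And>x. ((\<lambda>n. h n x) \<longlongrightarrow> V x) G" and "\<And>x. V x \<in> {0..w x}"
    by (rule pointwise_cluster_point[of h w, OF hw], rule that)
  have h_eq: "bellman (\<alpha> n) (h n) x = h n x + (1 - \<alpha> n) * discounted_value (\<alpha> n) x0" if x: "x \<in> X" for n x
  proof -
    let ?d = "discounted_value (\<alpha> n)"
    have av: "action_value (\<alpha> n) (h n) x v = action_value (\<alpha> n) ?d x v - \<alpha> n * ?d x0"
      if "v \<in> {0, 1}" for v
      using F_closed[OF x, of 0 v] F_closed[OF x, of 1 v] that
      by (simp add: cost_to_go_def h_def algebra_simps)
    have "bellman (\<alpha> n) (h n) x = bellman (\<alpha> n) ?d x - \<alpha> n * ?d x0"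
      unfolding bellman_def by (simp add: av min_diff_distrib_left)
    also have "bellman (\<alpha> n) ?d x = ?d x" using discounted_value_fixed_point[OF \<alpha> x] by simp
    finally have "bellman (\<alpha> n) (h n) x = ?d x - \<alpha> n * ?d x0" .
    moreover have "h n x = ?d x - ?d x0" using x by (simp add: h_def)
    ultimately show ?thesis by (simp add: algebra_simps)
  qed
  have h_x0: "h n x0 = 0" for n by (simp add: h_def)
  have \<alpha>_G: "(\<alpha> \<longlongrightarrow> 1) G" using \<alpha>_lim G(2) by (rule tendsto_mono[rotated])
  have lim: "((\<lambda>n. bellman (\<alpha> n) (h n) x) \<longlongrightarrow> bellman 1 V x) G" for x
    unfolding bellman_def cost_to_go_def
    by (intro tendsto_min tendsto_add tendsto_mult tendsto_const V \<alpha>_G)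
  define \<rho> where "\<rho> = bellman 1 V x0"
  have \<rho>_lim: "((\<lambda>n. (1 - \<alpha> n) * discounted_value (\<alpha> n) x0) \<longlongrightarrow> \<rho>) G"
    using lim[of x0] by (simp add: h_eq[OF x0] h_x0 \<rho>_def)
  have "\<rho> + V x = bellman 1 V x" if x: "x \<in> X" for x
  proof -
    have "((\<lambda>n. bellman (\<alpha> n) (h n) x) \<longlongrightarrow> V x + \<rho>) G"
      unfolding h_eq[OF x] by (rule tendsto_add[OF V \<rho>_lim])
    from tendsto_unique[OF G(1) lim[of x] this] show ?thesis by simp
  qed
  moreover have "0 \<le> V x \<and> V x \<le> slope * s" if "x \<in> X" "0 \<le> s" "le s x x0" for x s
    using tendsto_lowerbound[OF V[of x] _ G(1), of 0] tendsto_upperbound[OF V[of x] _ G(1), of "slope * s"]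
      h_bound[OF that] by (simp add: always_eventually)
  ultimately show ?thesis using that by blast
qed

text \<open>Along a trajectory the distance to \<open>x0\<close> satisfies \<open>s' \<le> \<kappa> s + b\<close>, and \<open>s + b / (1 - \<kappa>)\<close> bounds every
  such recursion started at \<open>s\<close>.\<close>

lemma bounded_invariant_set:
  assumes x: "x \<in> X"
  obtains Y c where "x \<in> Y" "Y \<subseteq> X" "\<And>y g v. y \<in> Y \<Longrightarrow> g \<in> {0, 1} \<Longrightarrow> v \<in> {0, 1} \<Longrightarrow> F y g v \<in> Y"
    "\<And>y. y \<in> Y \<Longrightarrow> \<exists>s. 0 \<le> s \<and> s \<le> c \<and> le s y x0"
proof -
  obtain s where s: "0 \<le> s" "le s x x0" using x0_reach[OF x] by blast
  define c where "c = s + b / (1 - \<kappa>)"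
  define Y where "Y = {y \<in> X. \<exists>t. 0 \<le> t \<and> t \<le> c \<and> le t y x0}"
  have "0 \<le> b / (1 - \<kappa>)" using b \<kappa> by simp
  have "x \<in> Y" using s x \<open>0 \<le> b / (1 - \<kappa>)\<close> by (auto simp: Y_def c_def)
  moreover have "F y g v \<in> Y" if y: "y \<in> Y" and gv: "g \<in> {0, 1}" "v \<in> {0, 1}" for y g v
  proof -
    obtain t where t: "y \<in> X" "0 \<le> t" "t \<le> c" "le t y x0" using y by (auto simp: Y_def)
    have "le (\<kappa> * t + b) (F y g v) x0"
      using le_trans[OF F_contr[OF t(2) t(1) x0 gv t(4)] x0_step[OF gv]] .
    moreover have "\<kappa> * t + b \<le> c"
    proof -
      have "\<kappa> * t + b \<le> \<kappa> * c + b" using t \<kappa> by (simp add: mult_left_mono)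
      also have "\<dots> = \<kappa> * s + b / (1 - \<kappa>)"
        using \<kappa> by (simp add: c_def divide_simps) (simp add: algebra_simps)
      also have "\<dots> \<le> c" using s \<kappa> by (simp add: c_def mult_left_le_one_le)
      finally show ?thesis .
    qed
    moreover have "0 \<le> \<kappa> * t + b" using t \<kappa> b by simp
    ultimately show ?thesis using F_closed[OF t(1) gv] by (auto simp: Y_def)
  qed
  moreover have "Y \<subseteq> X" by (auto simp: Y_def)
  moreover have "\<exists>s. 0 \<le> s \<and> s \<le> c \<and> le s y x0" if "y \<in> Y" for y
    using that unfolding Y_def by blast
  ultimately show ?thesis by (intro that[of Y c])
qed

end

section \<open>Expectations along independent receptions\<close>

locale reception_process = prob_space M for M :: "'w measure" +
  fixes \<gamma> :: "nat \<Rightarrow> 'w \<Rightarrow> real" and q :: real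
  assumes indep: "indep_vars (\<lambda>_. borel) \<gamma> UNIV"
    and binary: "\<And>k \<omega>. \<omega> \<in> space M \<Longrightarrow> \<gamma> k \<omega> \<in> {0, 1}"
    and prob_one: "\<And>k. prob {\<omega> \<in> space M. \<gamma> k \<omega> = 1} = q"
begin

definition weight :: "real \<Rightarrow> real" where "weight g = (if g = 1 then q else 1 - q)"

definition prefix :: "nat \<Rightarrow> 'w \<Rightarrow> real list" where "prefix k \<omega> = map (\<lambda>i. \<gamma> i \<omega>) [0..<k]"

definition words :: "nat \<Rightarrow> real list set" where "words k = {l. set l \<subseteq> {0, 1} \<and> length l = k}"

lemma finite_words: "finite (words k)"
  unfolding words_def by (rule finite_lists_length_eq) simp

lemma prefix_in_words: "\<omega> \<in> space M \<Longrightarrow> prefix k \<omega> \<in> words k"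
  using binary by (auto simp: words_def prefix_def)

lemma nth_words: "l \<in> words k \<Longrightarrow> i < k \<Longrightarrow> l ! i \<in> {0, 1}"
  unfolding words_def using nth_mem by blast

lemma letter_event: "\<gamma> i -` {a} \<inter> space M \<in> events"
proof -
  have "\<gamma> i \<in> borel_measurable M" using indep by (simp add: indep_vars_def2)
  then show ?thesis by (rule measurable_sets) simp
qed

lemma letter_prob:
  assumes "g \<in> {0, 1}" shows "prob (\<gamma> i -` {g} \<inter> space M) = weight g"
proof -
  have one: "prob (\<gamma> i -` {1} \<inter> space M) = q"
    using prob_one[of i] by (simp add: vimage_def Int_def conj_commute)
  have "\<gamma> i -` {0} \<inter> space M = space M - (\<gamma> i -` {1} \<inter> space M)"
    using binary[of _ i] by auto
  then have "prob (\<gamma> i -` {0} \<inter> space M) = 1 - q"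
    using prob_compl[OF letter_event[of i 1]] one by simp
  then show ?thesis using assms one by (auto simp: weight_def)
qed

lemma word_event:
  assumes "length l = k"
  shows "{\<omega> \<in> space M. prefix k \<omega> = l} = space M \<inter> (\<Inter>i<k. \<gamma> i -` {l ! i} \<inter> space M)"
  using assms by (auto simp: prefix_def list_eq_iff_nth_eq)

lemma word_measurable:
  assumes "length l = k" shows "{\<omega> \<in> space M. prefix k \<omega> = l} \<in> events"
proof (cases "k = 0")
  case True then show ?thesis using assms by (simp add: prefix_def)
next
  case False
  have "(\<Inter>i<k. \<gamma> i -` {l ! i} \<inter> space M) \<in> events"
    by (rule sets.finite_INT) (use letter_event False in auto)
  then show ?thesis unfolding word_event[OF assms] by (rule sets.Int[OF sets.top])
qed

lemma word_prob:
  assumes "l \<in> words k"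
  shows "prob {\<omega> \<in> space M. prefix k \<omega> = l} = (\<Prod>i<k. weight (l ! i))"
proof (cases "k = 0")
  case True then show ?thesis using assms prob_space by (simp add: words_def prefix_def)
next
  case False
  have l: "length l = k" "\<And>i. i < k \<Longrightarrow> l ! i \<in> {0, 1}"
    using assms nth_words[OF assms] by (simp_all add: words_def)
  have "space M \<inter> (\<Inter>i<k. \<gamma> i -` {l ! i} \<inter> space M) = (\<Inter>i<k. \<gamma> i -` {l ! i} \<inter> space M)"
    using False by auto
  then have "prob {\<omega> \<in> space M. prefix k \<omega> = l} = prob (\<Inter>i<k. \<gamma> i -` {l ! i} \<inter> space M)"
    using word_event[OF l(1)] by simp
  also have "\<dots> = (\<Prod>i<k. prob (\<gamma> i -` {l ! i} \<inter> space M))"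
    using False by (intro indep_varsD[OF indep]) auto
  also have "\<dots> = (\<Prod>i<k. weight (l ! i))"
    by (rule prod.cong) (use l letter_prob in auto)
  finally show ?thesis .
qed

text \<open>The past up to time \<open>k\<close> is one of finitely many words over \<open>{0, 1}\<close>, so expectations of functions
  of the past are finite sums and no integrability question arises.\<close>

definition expect :: "nat \<Rightarrow> (real list \<Rightarrow> real) \<Rightarrow> real" where
  "expect k \<phi> = (\<Sum>l\<in>words k. \<phi> l * (\<Prod>i<k. weight (l ! i)))"

lemma expectation_prefix: "(\<integral>\<omega>. \<phi> (prefix k \<omega>) \<partial>M) = expect k \<phi>"
proof -
  let ?E = "\<lambda>l. {\<omega> \<in> space M. prefix k \<omega> = l}"
  have "(\<integral>\<omega>. \<phi> (prefix k \<omega>) \<partial>M) = (\<integral>\<omega>. (\<Sum>l\<in>words k. \<phi> l * indicator (?E l) \<omega>) \<partial>M)"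
  proof (rule Bochner_Integration.integral_cong[OF refl])
    fix \<omega> assume \<omega>: "\<omega> \<in> space M"
    have "(\<Sum>l\<in>words k. \<phi> l * indicator (?E l) \<omega>) = (\<Sum>l\<in>words k. if l = prefix k \<omega> then \<phi> l else 0)"
      using \<omega> by (intro sum.cong) (auto simp: indicator_def)
    then show "\<phi> (prefix k \<omega>) = (\<Sum>l\<in>words k. \<phi> l * indicator (?E l) \<omega>)"
      using prefix_in_words[OF \<omega>] finite_words by simp
  qed
  also have "\<dots> = (\<Sum>l\<in>words k. \<integral>\<omega>. \<phi> l * indicator (?E l) \<omega> \<partial>M)"
    by (rule Bochner_Integration.integral_sum)
      (auto simp: words_def intro!: integrable_mult_right integrable_real_indicator word_measurable
        simp: less_top[symmetric])
  also have "\<dots> = (\<Sum>l\<in>words k. \<phi> l * prob (?E l))"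
  proof (rule sum.cong[OF refl])
    fix l assume "l \<in> words k"
    then have "?E l \<in> events" by (intro word_measurable) (simp add: words_def)
    then show "(\<integral>\<omega>. \<phi> l * indicator (?E l) \<omega> \<partial>M) = \<phi> l * prob (?E l)"
      by (simp add: Int_absorb2 sets.sets_into_space)
  qed
  also have "\<dots> = expect k \<phi>"
    unfolding expect_def by (rule sum.cong) (simp_all add: word_prob)
  finally show ?thesis .
qed

text \<open>Conditioning on the first \<open>k\<close> receptions.\<close>

lemma expect_append:
  "expect (Suc k) \<phi> = expect k (\<lambda>l. (1 - q) * \<phi> (l @ [0]) + q * \<phi> (l @ [1]))"
proof -
  have words_Suc: "words (Suc k) = (\<lambda>(l, g). l @ [g]) ` (words k \<times> {0, 1})"
  proof (intro set_eqI iffI)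
    fix l assume l: "l \<in> words (Suc k)"
    then have "l \<noteq> []" by (auto simp: words_def)
    then obtain l' g where eq: "l = l' @ [g]" using append_butlast_last_id by metis
    with l have "l' \<in> words k" "g \<in> {0, 1}" by (auto simp: words_def)
    with eq show "l \<in> (\<lambda>(l, g). l @ [g]) ` (words k \<times> {0, 1})" by force
  qed (auto simp: words_def)
  have inj: "inj_on (\<lambda>(l, g). l @ [g]) (words k \<times> {0, 1})" by (auto simp: inj_on_def)
  have w: "(\<Prod>i<Suc k. weight ((l @ [g]) ! i)) = (\<Prod>i<k. weight (l ! i)) * weight g"
    if "l \<in> words k" for l g
    using that by (simp add: words_def nth_append)
  have "expect (Suc k) \<phi> = (\<Sum>(l, g)\<in>words k \<times> {0, 1}. \<phi> (l @ [g]) * (\<Prod>i<Suc k. weight ((l @ [g]) ! i)))"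
    unfolding expect_def words_Suc sum.reindex[OF inj] by (simp add: case_prod_beta comp_def)
  also have "\<dots> = (\<Sum>l\<in>words k. \<Sum>g\<in>{0, 1}. \<phi> (l @ [g]) * ((\<Prod>i<k. weight (l ! i)) * weight g))"
    unfolding sum.cartesian_product[symmetric] by (intro sum.cong refl) (simp only: w)
  also have "\<dots> = expect k (\<lambda>l. (1 - q) * \<phi> (l @ [0]) + q * \<phi> (l @ [1]))"
    unfolding expect_def by (rule sum.cong) (simp_all add: weight_def algebra_simps)
  finally show ?thesis .
qed

lemma q_bounds: "0 \<le> q" "q \<le> 1"
  using prob_one[of 0] by (auto simp flip: prob_one[of 0])

lemma expect_mono:
  assumes "\<And>l. l \<in> words k \<Longrightarrow> \<phi> l \<le> \<psi> l" shows "expect k \<phi> \<le> expect k \<psi>"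
  unfolding expect_def
  by (intro sum_mono mult_right_mono assms prod_nonneg) (auto simp: weight_def q_bounds)

lemma expect_add: "expect k (\<lambda>l. \<phi> l + \<psi> l) = expect k \<phi> + expect k \<psi>"
  by (simp add: expect_def distrib_right sum.distrib)

lemma expect_const: "expect k (\<lambda>_. c) = c"
  using expectation_prefix[of "\<lambda>_. c" k] prob_space by simp

end

lemma decisions_cong:
  assumes "\<And>i. i < k \<Longrightarrow> g i = g' i"
  shows "decisions \<pi> P0 g k = decisions \<pi> P0 g' k"
  using assms
proof (induction k)
  case (Suc k)
  have "map g [0..<k] = map g' [0..<k]" "decisions \<pi> P0 g k = decisions \<pi> P0 g' k"
    using Suc by simp_all
  then show ?case by (simp only: decisions.simps)
qed simp

lemma decision_cong:
  assumes "\<And>i. i < k \<Longrightarrow> g i = g' i"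
  shows "decision \<pi> P0 g k = decision \<pi> P0 g' k"
proof -
  have "map g [0..<k] = map g' [0..<k]" using assms by simp
  moreover have "decisions \<pi> P0 g k = decisions \<pi> P0 g' k"
    by (rule decisions_cong) (rule assms)
  ultimately show ?thesis by (simp only: decision_def)
qed

lemma trajectory_cong:
  assumes "\<And>i. i < k \<Longrightarrow> g i = g' i"
  shows "trajectory L Ps \<pi> P0 g k = trajectory L Ps \<pi> P0 g' k"
  using assms
proof (induction k)
  case (Suc k)
  have "trajectory L Ps \<pi> P0 g k = trajectory L Ps \<pi> P0 g' k" "g k = g' k"
    using Suc by simp_all
  moreover have "decision \<pi> P0 g k = decision \<pi> P0 g' k"
    by (rule decision_cong) (simp add: Suc.prems)
  ultimately show ?case by (simp only: trajectory.simps)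
qed simp

definition greedy :: "('s \<Rightarrow> real \<Rightarrow> real) \<Rightarrow> 's \<Rightarrow> real" where
  "greedy h x = (if h x 0 \<le> h x 1 then 0 else 1)"

lemma greedy_min: "h x (greedy h x) = min (h x 0) (h x 1)"
  by (simp add: greedy_def min_def)

text \<open>The policy recomputes the current state from the receptions alone; its own past decisions are
  determined by them.\<close>

definition greedy_policy where
  "greedy_policy L Ps h gs vs P0 = greedy h (foldl (\<lambda>x g. L x g (greedy h x)) (embed Ps P0) gs)"

lemma greedy_policy_policies: "greedy_policy L Ps h \<in> policies"
  by (simp add: policies_def greedy_policy_def greedy_def)

lemma decision_greedy_policy:
  "decision (greedy_policy L Ps h) P0 g k = greedy h (trajectory L Ps (greedy_policy L Ps h) P0 g k)"
proof -
  have "trajectory L Ps (greedy_policy L Ps h) P0 g k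
      = foldl (\<lambda>x g. L x g (greedy h x)) (embed Ps P0) (map g [0..<k])"
    by (induction k) (simp_all add: decision_def greedy_policy_def)
  then show ?thesis by (simp add: decision_def greedy_policy_def)
qed

lemma decision_binary: "\<pi> \<in> policies \<Longrightarrow> decision \<pi> P0 g k \<in> {0, 1}"
  by (simp add: policies_def decision_def)

context reception_process
begin

lemma
  fixes L :: "real^('n::finite + 'n)^('n + 'n) \<Rightarrow> real \<Rightarrow> real \<Rightarrow> real^('n + 'n)^('n + 'n)"
    and Ps P0 :: "real^'n^'n"
    and V :: "real^('n + 'n)^('n + 'n) \<Rightarrow> real"
    and r :: "real^('n + 'n)^('n + 'n) \<Rightarrow> real \<Rightarrow> real" and \<pi> :: "'n policy"
  defines "traj \<equiv> \<lambda>g. trajectory L Ps \<pi> P0 g"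
  defines "v \<equiv> \<lambda>k. \<integral>\<omega>. V (traj (\<lambda>i. \<gamma> i \<omega>) k) \<partial>M"
  defines "c \<equiv> \<lambda>k. \<integral>\<omega>. r (traj (\<lambda>i. \<gamma> i \<omega>) (Suc k)) (decision \<pi> P0 (\<lambda>i. \<gamma> i \<omega>) k) \<partial>M"
  shows expected_step_word: "v k = expect k (\<lambda>l. V (traj ((!) l) k))"
    and expected_step: "c k + v (Suc k)
      = expect k (\<lambda>l. cost_to_go q r L V (traj ((!) l) k) (decision \<pi> P0 ((!) l) k))"
proof -
  have v: "v k = expect k (\<lambda>l. V (traj ((!) l) k))" for k
  proof -
    have "trajectory L Ps \<pi> P0 (\<lambda>i. \<gamma> i \<omega>) k = trajectory L Ps \<pi> P0 ((!) (prefix k \<omega>)) k" for \<omega>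
      by (rule trajectory_cong) (simp add: prefix_def)
    then show ?thesis unfolding v_def traj_def expectation_prefix[symmetric] by simp
  qed
  then show "v k = expect k (\<lambda>l. V (traj ((!) l) k))" .
  have c: "c k = expect (Suc k) (\<lambda>l. r (traj ((!) l) (Suc k)) (decision \<pi> P0 ((!) l) k))"
  proof -
    have "trajectory L Ps \<pi> P0 (\<lambda>i. \<gamma> i \<omega>) (Suc k) = trajectory L Ps \<pi> P0 ((!) (prefix (Suc k) \<omega>)) (Suc k)"
      "decision \<pi> P0 (\<lambda>i. \<gamma> i \<omega>) k = decision \<pi> P0 ((!) (prefix (Suc k) \<omega>)) k" for \<omega>
      by (rule trajectory_cong decision_cong, simp add: prefix_def nth_append del: upt_Suc)+
    then show ?thesis unfolding c_def traj_def expectation_prefix[symmetric] by presburger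
  qed
  have snoc: "traj ((!) (l @ [g])) (Suc k) = L (traj ((!) l) k) g (decision \<pi> P0 ((!) l) k)"
    "decision \<pi> P0 ((!) (l @ [g])) k = decision \<pi> P0 ((!) l) k" if "length l = k" for l g
  proof -
    have "traj ((!) (l @ [g])) k = traj ((!) l) k"
      unfolding traj_def by (rule trajectory_cong) (simp add: nth_append that)
    moreover show "decision \<pi> P0 ((!) (l @ [g])) k = decision \<pi> P0 ((!) l) k"
      by (rule decision_cong) (simp add: nth_append that)
    ultimately show "traj ((!) (l @ [g])) (Suc k) = L (traj ((!) l) k) g (decision \<pi> P0 ((!) l) k)"
      by (simp add: traj_def nth_append that)
  qed
  have "c k + v (Suc k) = expect (Suc k) (\<lambda>l. r (traj ((!) l) (Suc k)) (decision \<pi> P0 ((!) l) k)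
      + V (traj ((!) l) (Suc k)))"
    by (simp only: c v expect_add)
  also have "\<dots> = expect k (\<lambda>l. cost_to_go q r L V (traj ((!) l) k) (decision \<pi> P0 ((!) l) k))"
    unfolding expect_append
  proof (unfold expect_def, rule sum.cong[OF refl])
    fix l assume "l \<in> words k"
    then have "length l = k" by (simp add: words_def)
    then show "((1 - q) * (r (traj ((!) (l @ [0])) (Suc k)) (decision \<pi> P0 ((!) (l @ [0])) k)
          + V (traj ((!) (l @ [0])) (Suc k)))
        + q * (r (traj ((!) (l @ [1])) (Suc k)) (decision \<pi> P0 ((!) (l @ [1])) k)
          + V (traj ((!) (l @ [1])) (Suc k)))) * (\<Prod>i<k. weight (l ! i))
      = cost_to_go q r L V (traj ((!) l) k) (decision \<pi> P0 ((!) l) k) * (\<Prod>i<k. weight (l ! i))"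
      by (simp only: snoc cost_to_go_def)
  qed
  finally show "c k + v (Suc k)
      = expect k (\<lambda>l. cost_to_go q r L V (traj ((!) l) k) (decision \<pi> P0 ((!) l) k))" .
qed

lemma trajectory_invariant:
  assumes "embed Ps P0 \<in> Y"
    and "\<And>y g v. y \<in> Y \<Longrightarrow> g \<in> {0, 1} \<Longrightarrow> v \<in> {0, 1} \<Longrightarrow> L y g v \<in> Y"
    and "\<pi> \<in> policies" "\<And>i. i < k \<Longrightarrow> g i \<in> {0, 1}"
  shows "trajectory L Ps \<pi> P0 g k \<in> Y"
  using assms(4)
proof (induction k)
  case 0 then show ?case by (simp add: assms)
next
  case (Suc k)
  then show ?case using assms(2) decision_binary[OF assms(3)] by simp
qed

context
  fixes L :: "real^('n::finite + 'n)^('n + 'n) \<Rightarrow> real \<Rightarrow> real \<Rightarrow> real^('n + 'n)^('n + 'n)"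
    and Ps P0 :: "real^'n^'n" and J :: "real \<Rightarrow> real" and lam \<rho> B :: real
    and Y :: "(real^('n + 'n)^('n + 'n)) set"
    and V :: "real^('n + 'n)^('n + 'n) \<Rightarrow> real"
  assumes start: "embed Ps P0 \<in> Y"
    and closed: "\<And>y g v. y \<in> Y \<Longrightarrow> g \<in> {0, 1} \<Longrightarrow> v \<in> {0, 1} \<Longrightarrow> L y g v \<in> Y"
    and bounded: "\<And>y. y \<in> Y \<Longrightarrow> \<bar>V y\<bar> \<le> B"
begin

abbreviation "stage_cost \<equiv> \<lambda>x \<nu>. lam * trace (upper_left x) + (1 - lam) * J \<nu>"

abbreviation "Qfun \<equiv> cost_to_go q stage_cost L V"

lemma average_telescope:
  assumes \<pi>: "\<pi> \<in> policies"
  obtains v where "\<And>k. \<bar>v k\<bar> \<le> B"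
    "average_cost M \<gamma> L Ps J lam \<pi> P0
      = limsup (\<lambda>T. ereal (1 / real T * (\<Sum>k<T. expect k (\<lambda>l. Qfun (trajectory L Ps \<pi> P0 ((!) l) k)
            (decision \<pi> P0 ((!) l) k)) - v (Suc k))))"
    "\<And>k. v k = expect k (\<lambda>l. V (trajectory L Ps \<pi> P0 ((!) l) k))"
proof -
  define v where "v k = (\<integral>\<omega>. V (trajectory L Ps \<pi> P0 (\<lambda>i. \<gamma> i \<omega>) k) \<partial>M)" for k
  have v: "v k = expect k (\<lambda>l. V (trajectory L Ps \<pi> P0 ((!) l) k))" for k
    unfolding v_def by (rule expected_step_word)
  have V: "\<bar>V (trajectory L Ps \<pi> P0 ((!) l) k)\<bar> \<le> B" if l: "l \<in> words k" for l k
  proof (intro bounded trajectory_invariant start closed \<pi>)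
    fix i assume "i < k"
    then show "l ! i \<in> {0, 1}" by (rule nth_words[OF l])
  qed auto
  have "\<bar>v k\<bar> \<le> B" for k
  proof -
    have "expect k (\<lambda>l. V (trajectory L Ps \<pi> P0 ((!) l) k)) \<le> expect k (\<lambda>_. B)"
      "expect k (\<lambda>_. - B) \<le> expect k (\<lambda>l. V (trajectory L Ps \<pi> P0 ((!) l) k))"
      using V by (intro expect_mono; force)+
    then show ?thesis by (simp add: v expect_const)
  qed
  moreover have "average_cost M \<gamma> L Ps J lam \<pi> P0
      = limsup (\<lambda>T. ereal (1 / real T * (\<Sum>k<T. expect k (\<lambda>l. Qfun (trajectory L Ps \<pi> P0 ((!) l) k)
            (decision \<pi> P0 ((!) l) k)) - v (Suc k))))"
    unfolding average_cost_def expected_step[symmetric] v_def by simp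
  ultimately show ?thesis using that v by blast
qed

text \<open>The boundary term \<open>v 0 - v T\<close> is bounded, hence negligible after division by \<open>T\<close>.\<close>

lemma average_of_telescope:
  assumes v: "\<And>k. \<bar>v k :: real\<bar> \<le> B"
  shows "(\<lambda>T. ereal (1 / real T * (\<Sum>k<T. \<rho> + v k - v (Suc k)))) \<longlonglongrightarrow> ereal \<rho>"
proof -
  have sum: "(\<Sum>k<T. \<rho> + v k - v (Suc k)) = real T * \<rho> + (v 0 - v T)" for T
    by (induction T) (simp_all add: algebra_simps)
  have "(\<lambda>T. (v 0 - v T) / real T) \<longlonglongrightarrow> 0"
  proof (rule Lim_null_comparison)
    have "\<bar>v 0 - v T\<bar> \<le> 2 * B" for T using v[of 0] v[of T] by linarith
    then show "\<forall>\<^sub>F T in sequentially. norm ((v 0 - v T) / real T) \<le> 2 * B / real T"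
      by (intro always_eventually allI) (simp add: divide_right_mono)
    show "(\<lambda>T. 2 * B / real T) \<longlonglongrightarrow> 0" by (rule lim_const_over_n)
  qed
  then have "(\<lambda>T. \<rho> + (v 0 - v T) / real T) \<longlonglongrightarrow> \<rho> + 0" by (intro tendsto_add tendsto_const)
  moreover have "\<forall>\<^sub>F T in sequentially.
      \<rho> + (v 0 - v T) / real T = 1 / real T * (\<Sum>k<T. \<rho> + v k - v (Suc k))"
    using eventually_gt_at_top[of 0] by eventually_elim (simp add: sum add_divide_distrib)
  ultimately have "(\<lambda>T. 1 / real T * (\<Sum>k<T. \<rho> + v k - v (Suc k))) \<longlonglongrightarrow> \<rho>"
    using tendsto_cong by fastforce
  then show ?thesis by simp
qed

lemma average_cost_lower_bound:
  assumes \<pi>: "\<pi> \<in> policies"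
    and ineq: "\<And>y u. y \<in> Y \<Longrightarrow> u \<in> {0, 1} \<Longrightarrow> \<rho> + V y \<le> Qfun y u"
  shows "ereal \<rho> \<le> average_cost M \<gamma> L Ps J lam \<pi> P0"
proof -
  obtain v where v: "\<And>k. \<bar>v k\<bar> \<le> B"
    and avg: "average_cost M \<gamma> L Ps J lam \<pi> P0
      = limsup (\<lambda>T. ereal (1 / real T * (\<Sum>k<T. expect k (\<lambda>l. Qfun (trajectory L Ps \<pi> P0 ((!) l) k)
            (decision \<pi> P0 ((!) l) k)) - v (Suc k))))"
    and v_eq: "\<And>k. v k = expect k (\<lambda>l. V (trajectory L Ps \<pi> P0 ((!) l) k))"
    using average_telescope[OF \<pi>] by blast
  have step: "\<rho> + v k \<le> expect k (\<lambda>l. Qfun (trajectory L Ps \<pi> P0 ((!) l) k) (decision \<pi> P0 ((!) l) k))" for k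
  proof -
    have "\<rho> + v k = expect k (\<lambda>l. \<rho> + V (trajectory L Ps \<pi> P0 ((!) l) k))"
      by (simp add: expect_add expect_const v_eq)
    also have "\<dots> \<le> expect k (\<lambda>l. Qfun (trajectory L Ps \<pi> P0 ((!) l) k) (decision \<pi> P0 ((!) l) k))"
    proof (rule expect_mono, rule ineq)
      fix l assume l: "l \<in> words k"
      show "trajectory L Ps \<pi> P0 ((!) l) k \<in> Y"
        using nth_words[OF l] by (intro trajectory_invariant start closed \<pi>) auto
      show "decision \<pi> P0 ((!) l) k \<in> {0, 1}" by (rule decision_binary[OF \<pi>])
    qed
    finally show ?thesis .
  qed
  have "ereal \<rho> = limsup (\<lambda>T. ereal (1 / real T * (\<Sum>k<T. \<rho> + v k - v (Suc k))))"
    using lim_imp_Limsup[OF _ average_of_telescope[of v, OF v]] by simp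
  also have "\<dots> \<le> average_cost M \<gamma> L Ps J lam \<pi> P0"
    unfolding avg using step
    by (intro Limsup_mono always_eventually allI) (auto intro!: mult_left_mono sum_mono divide_right_mono)
  finally show ?thesis .
qed

lemma greedy_policy_optimal:
  assumes eq: "\<And>y. y \<in> Y \<Longrightarrow> \<rho> + V y = min (Qfun y 0) (Qfun y 1)"
  shows "average_cost M \<gamma> L Ps J lam (greedy_policy L Ps Qfun) P0 = ereal \<rho>"
proof -
  let ?\<pi> = "greedy_policy L Ps Qfun :: 'n policy"
  obtain v where v: "\<And>k. \<bar>v k\<bar> \<le> B"
    and avg: "average_cost M \<gamma> L Ps J lam ?\<pi> P0
      = limsup (\<lambda>T. ereal (1 / real T * (\<Sum>k<T. expect k (\<lambda>l. Qfun (trajectory L Ps ?\<pi> P0 ((!) l) k)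
            (decision ?\<pi> P0 ((!) l) k)) - v (Suc k))))"
    and v_eq: "\<And>k. v k = expect k (\<lambda>l. V (trajectory L Ps ?\<pi> P0 ((!) l) k))"
    using average_telescope[OF greedy_policy_policies] by blast
  have step: "expect k (\<lambda>l. Qfun (trajectory L Ps ?\<pi> P0 ((!) l) k) (decision ?\<pi> P0 ((!) l) k)) = \<rho> + v k" for k
  proof -
    have "\<rho> + v k = expect k (\<lambda>l. \<rho> + V (trajectory L Ps ?\<pi> P0 ((!) l) k))"
      by (simp add: expect_add expect_const v_eq)
    also have "\<dots> = expect k (\<lambda>l. Qfun (trajectory L Ps ?\<pi> P0 ((!) l) k) (decision ?\<pi> P0 ((!) l) k))"
      unfolding expect_def
    proof (rule sum.cong[OF refl])
      fix l assume l: "l \<in> words k"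
      have "trajectory L Ps ?\<pi> P0 ((!) l) k \<in> Y"
        using nth_words[OF l]
        by (intro trajectory_invariant start closed greedy_policy_policies) auto
      from eq[OF this] show "(\<rho> + V (trajectory L Ps ?\<pi> P0 ((!) l) k)) * (\<Prod>i<k. weight (l ! i))
          = Qfun (trajectory L Ps ?\<pi> P0 ((!) l) k) (decision ?\<pi> P0 ((!) l) k) * (\<Prod>i<k. weight (l ! i))"
        by (simp only: decision_greedy_policy greedy_min)
    qed
    finally show ?thesis by simp
  qed
  show ?thesis
    unfolding avg step using lim_imp_Limsup[OF _ average_of_telescope[of v, OF v]] by simp
qed

end

end

section \<open>Contraction of the estimation error and the main result\<close>

text \<open>The excess covariance after the (possible) reception and before the propagation by \<open>A\<close>. A received
  innovation is informative only about the part \<open>W\<close>, a received estimate about all of \<open>D + W\<close>.\<close>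

definition posterior ::
  "real^'n^'n \<Rightarrow> real^'n^'n \<Rightarrow> real^'n^'n \<Rightarrow> real \<Rightarrow> real \<Rightarrow> real^'n^'n \<Rightarrow> real^'n^'n" where
  "posterior W \<Sigma>x \<Sigma>e g \<nu> D = (if g = 0 then D + W
     else if \<nu> = 0 then D + filtered_cov \<Sigma>e W else filtered_cov \<Sigma>x (D + W))"

lemma psd_posterior:
  assumes "psd D" "psd W" "psd \<Sigma>x" "psd \<Sigma>e" "invertible (D + W + \<Sigma>x)" "invertible (W + \<Sigma>e)"
  shows "psd (posterior W \<Sigma>x \<Sigma>e g \<nu> D)"
  unfolding posterior_def using assms by (auto intro!: psd_add psd_filtered_cov)

lemma posterior_le_prior:
  assumes "psd D" "psd W" "psd \<Sigma>x" "psd \<Sigma>e" "invertible (D + W + \<Sigma>x)" "invertible (W + \<Sigma>e)"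
  shows "psd (D + W - posterior W \<Sigma>x \<Sigma>e g \<nu> D)"
proof -
  have reduction: "psd (Y - filtered_cov \<Sigma> Y)" if "psd Y" "psd \<Sigma>" "invertible (Y + \<Sigma>)" for Y \<Sigma> :: "real^'a^'a"
    using psd_congruence[OF psd_matrix_inv[OF that(3) psd_add[OF that(1,2)]], of Y] that(1)
    by (simp add: filtered_cov_def psd_def)
  show ?thesis
    using reduction[of W \<Sigma>e] reduction[of "D + W" \<Sigma>x] assms
    by (auto simp: posterior_def psd_zero psd_add)
qed

lemma posterior_nonexpansive:
  assumes D: "psd D1" "psd D2" and W: "psd W" and \<Theta>: "psd \<Theta>" and \<alpha>: "0 \<le> \<alpha>" and s: "0 \<le> s"
    and inv: "invertible (D1 + W + \<alpha> *\<^sub>R \<Theta>)" "invertible (D2 + W + \<alpha> *\<^sub>R \<Theta>)"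
    and le: "psd (D2 + s *\<^sub>R \<Theta> - D1)"
  shows "psd (posterior W (\<alpha> *\<^sub>R \<Theta>) \<Sigma>e g \<nu> D2 + s *\<^sub>R \<Theta> - posterior W (\<alpha> *\<^sub>R \<Theta>) \<Sigma>e g \<nu> D1)"
proof -
  have "psd (D2 + W + s *\<^sub>R \<Theta> - (D1 + W))" using le by (simp add: algebra_simps)
  from filtered_cov_nonexpansive[OF psd_add[OF D(1) W] psd_add[OF D(2) W] \<Theta> \<alpha> s inv this]
  show ?thesis using le by (simp add: posterior_def algebra_simps)
qed

lemma contraction_step:
  fixes A :: "real^'n^'n"
  assumes le: "psd (G2 + s *\<^sub>R \<Theta> - G1)" and s: "0 \<le> s" and drop: "psd (\<kappa> *\<^sub>R \<Theta> - A ** \<Theta> ** transpose A)"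
  shows "psd (A ** G2 ** transpose A + (\<kappa> * s) *\<^sub>R \<Theta> - A ** G1 ** transpose A)"
proof -
  have "psd (A ** (G2 + s *\<^sub>R \<Theta> - G1) ** transpose A + s *\<^sub>R (\<kappa> *\<^sub>R \<Theta> - A ** \<Theta> ** transpose A))"
    by (intro psd_add psd_congruence psd_scaleR le s drop)
  then show ?thesis by (simp add: matrix_ring algebra_simps)
qed

lemma state_space_iff: "x \<in> state_space Ps \<longleftrightarrow> (\<exists>D. psd D \<and> x = embed Ps (Ps + D))"
proof
  assume "x \<in> state_space Ps"
  then obtain P where "psd (P - Ps)" "x = embed Ps P" by (auto simp: state_space_def)
  then show "\<exists>D. psd D \<and> x = embed Ps (Ps + D)" by (intro exI[of _ "P - Ps"]) simp
next
  assume "\<exists>D. psd D \<and> x = embed Ps (Ps + D)"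
  then obtain D where "psd D" "x = embed Ps (Ps + D)" by blast
  then show "x \<in> state_space Ps"
    unfolding state_space_def by (intro CollectI exI[of _ "Ps + D"]) simp
qed

lemma trace_scaleR: "trace (r *\<^sub>R A) = r * trace (A :: real^'n^'n)"
  by (simp add: trace_def sum_distrib_left)

theorem mainTheorem1:
  fixes A \<Sigma>w Ps \<Sigma>s \<Sigma>qx \<Sigma>qe :: "real^'n^'n"
    and C :: "real^'n^'m"
    and \<Sigma>v :: "real^'m^'m"
    and Kf Ks :: "real^'m^'n"
    and AA Q :: "real^('n + 'n)^('n + 'n)"
    and CC :: "real \<Rightarrow> real^('n + 'n)^'n"
    and S :: "real^'n^('n + 'n)"
    and R :: "real \<Rightarrow> real^'n^'n"
    and L :: "real^('n + 'n)^('n + 'n) \<Rightarrow> real \<Rightarrow> real \<Rightarrow> real^('n + 'n)^('n + 'n)"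
    and \<alpha>0 \<alpha>1 lam p :: real
    and nrate Eb J :: "real \<Rightarrow> real"
    and M :: "'w measure"
    and \<gamma> :: "nat \<Rightarrow> 'w \<Rightarrow> real"
  assumes "schur_stable A" and "detectable A C"
    and "psd \<Sigma>w" and "pos_def \<Sigma>v"
    and "psd Ps"
    and "Ps = A ** Ps ** transpose A + \<Sigma>w
              - A ** Ps ** transpose C ** matrix_inv (C ** Ps ** transpose C + \<Sigma>v)
                ** C ** Ps ** transpose A"
    and "Kf = Ps ** transpose C ** matrix_inv (C ** Ps ** transpose C + \<Sigma>v)"
    and "Ks = A ** Kf"
    and "\<Sigma>s = A ** \<Sigma>s ** transpose A + Ks ** (C ** Ps ** transpose C + \<Sigma>v) ** transpose Ks"
    and "\<alpha>0 \<ge> 0" and "\<alpha>1 \<ge> 0"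
    and "\<Sigma>qx = \<alpha>1 *\<^sub>R (\<Sigma>s + Kf ** (C ** Ps ** transpose C + \<Sigma>v) ** transpose Kf)"
    and "\<Sigma>qe = \<alpha>0 *\<^sub>R (Kf ** (C ** Ps ** transpose C + \<Sigma>v) ** transpose Kf)"
    and "trace \<Sigma>qx = trace \<Sigma>qe"
    and "AA = block A 0 (Ks ** C) (A - Ks ** C)"
    and "CC = (\<lambda>\<nu>. hcat (Kf ** C) (\<nu> *\<^sub>R mat 1 - Kf ** C))"
    and "Q = block \<Sigma>w 0 0 (Ks ** \<Sigma>v ** transpose Ks)"
    and "S = vcat 0 (Ks ** \<Sigma>v ** transpose Kf)"
    and "R = (\<lambda>\<nu>. Kf ** \<Sigma>v ** transpose Kf + \<nu>\<^sup>2 *\<^sub>R \<Sigma>qx + (1 - \<nu>)\<^sup>2 *\<^sub>R \<Sigma>qe)"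
    and "L = riccati AA CC Q S R"
    and "\<forall>P \<in> state_space Ps. \<forall>\<nu> \<in> {0, 1}. invertible (innovation_cov CC R P \<nu>)"
    and "0 \<le> nrate 0" and "nrate 0 \<le> nrate 1"
    and "0 \<le> Eb 0" and "Eb 0 \<le> Eb 1"
    and "J = (\<lambda>\<nu>. nrate \<nu> * Eb \<nu>)"
    and "0 \<le> lam" and "lam \<le> 1"
    and "0 \<le> p" and "p \<le> 1"
    and "prob_space M"
    and "prob_space.indep_vars M (\<lambda>_. borel) \<gamma> UNIV"
    and "\<forall>k. \<forall>\<omega> \<in> space M. \<gamma> k \<omega> \<in> {0, 1}"
    and "\<forall>k. measure M {\<omega> \<in> space M. \<gamma> k \<omega> = 1} = 1 - p"
  shows "\<exists>(\<rho> :: real) (V :: real^('n + 'n)^('n + 'n) \<Rightarrow> real).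
      (\<forall>P0. psd (P0 - Ps) \<longrightarrow>
         (\<exists>\<pi> \<in> policies. average_cost M \<gamma> L Ps J lam \<pi> P0 = ereal \<rho>) \<and>
         (\<forall>\<pi> \<in> policies. ereal \<rho> \<le> average_cost M \<gamma> L Ps J lam \<pi> P0)) \<and>
      (\<forall>P \<in> state_space Ps.
         \<rho> + V P = Min ((\<lambda>\<nu>.
             measure_pmf.expectation (bernoulli_pmf (1 - p))
               (\<lambda>g. lam * trace (upper_left (L P (of_bool g) \<nu>)) + (1 - lam) * J \<nu>)
             + measure_pmf.expectation (bernoulli_pmf (1 - p))
               (\<lambda>g. V (L P (of_bool g) \<nu>))) ` {0, 1}))"
proof -
  note stable = assms(1) and psd_Ps = assms(5) and are = assms(6) and Kf = assms(7) and Ks = assms(8)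
    and lyapunov = assms(9) and \<alpha>0 = assms(10) and \<alpha>1 = assms(11) and \<Sigma>qx = assms(12) and \<Sigma>qe = assms(13)
    and L = assms(20) and inv = assms(21) and J = assms(26) and lam = assms(27,28) and p = assms(29,30)
  have M: "pos_def (C ** Ps ** transpose C + \<Sigma>v)"
    using psd_add_pos_def[OF psd_congruence[OF psd_Ps] assms(4)] .
  define W where "W = Kf ** (C ** Ps ** transpose C + \<Sigma>v) ** transpose Kf"
  have W: "psd W" unfolding W_def by (rule psd_congruence[OF pos_def_psd[OF M]])
  have lyapunov': "\<Sigma>s = A ** \<Sigma>s ** transpose A + A ** W ** transpose A"
    using lyapunov by (simp add: W_def Ks matrix_transpose_mul matrix_mul_assoc)
  \<comment> \<open>The only use of stability; afterwards the decay of \<open>A\<close> is expressed through \<open>\<Theta>\<close>.\<close>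
  have \<Sigma>s: "psd \<Sigma>s"
    by (rule lyapunov_solution_psd[OF stable lyapunov' psd_congruence[OF W]])
  define \<Theta> where "\<Theta> = \<Sigma>s + W"
  have \<Theta>: "psd \<Theta>" unfolding \<Theta>_def by (rule psd_add[OF \<Sigma>s W])
  have x\<Theta>: "\<Sigma>qx = \<alpha>1 *\<^sub>R \<Theta>" by (simp add: \<Sigma>qx \<Theta>_def W_def)
  have eW: "\<Sigma>qe = \<alpha>0 *\<^sub>R W" by (simp add: \<Sigma>qe W_def)
  have psd_x: "psd \<Sigma>qx" and psd_e: "psd \<Sigma>qe"
    unfolding x\<Theta> eW by (intro psd_scaleR \<alpha>0 \<alpha>1 \<Theta> W)+

  have cov: "innovation_cov CC R (embed Ps (Ps + D)) \<nu>
      = W + \<nu>\<^sup>2 *\<^sub>R (D + \<Sigma>qx) + (1 - \<nu>)\<^sup>2 *\<^sub>R \<Sigma>qe"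
    and step: "L (embed Ps (Ps + D)) g \<nu> = embed Ps (Ps + A ** (D + W - g *\<^sub>R ((W + \<nu> *\<^sub>R D)
        ** matrix_inv (W + \<nu>\<^sup>2 *\<^sub>R (D + \<Sigma>qx) + (1 - \<nu>)\<^sup>2 *\<^sub>R \<Sigma>qe) ** (W + \<nu> *\<^sub>R D))) ** transpose A)"
    if "psd D" for D g \<nu>
  proof -
    have sym: "transpose Ps = Ps" "transpose D = D" "transpose \<Sigma>v = \<Sigma>v"
      using psd_Ps that assms(4) by (simp_all add: psd_def pos_def_def)
    note facts = sym(1,2) pos_def_invertible[OF M] sym(3) are Kf Ks assms(15-19)
    show "innovation_cov CC R (embed Ps (Ps + D)) \<nu>
        = W + \<nu>\<^sup>2 *\<^sub>R (D + \<Sigma>qx) + (1 - \<nu>)\<^sup>2 *\<^sub>R \<Sigma>qe"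
      unfolding W_def by (rule innovation_cov_embed[OF facts])
    show "L (embed Ps (Ps + D)) g \<nu> = embed Ps (Ps + A ** (D + W - g *\<^sub>R ((W + \<nu> *\<^sub>R D)
        ** matrix_inv (W + \<nu>\<^sup>2 *\<^sub>R (D + \<Sigma>qx) + (1 - \<nu>)\<^sup>2 *\<^sub>R \<Sigma>qe) ** (W + \<nu> *\<^sub>R D))) ** transpose A)"
      unfolding L W_def by (rule riccati_embed[OF facts])
  qed
  have inv_x: "invertible (D + W + \<alpha>1 *\<^sub>R \<Theta>)" if "psd D" for D
  proof -
    have "embed Ps (Ps + D) \<in> state_space Ps" using that by (auto simp: state_space_iff)
    then have "invertible (innovation_cov CC R (embed Ps (Ps + D)) 1)" using inv by blast
    then show ?thesis by (simp add: cov[OF that] x\<Theta> add.assoc add.left_commute)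
  qed
  have inv_e: "invertible (W + \<Sigma>qe)"
  proof -
    have "embed Ps (Ps + 0) \<in> state_space Ps" using psd_zero by (subst state_space_iff) blast
    then have "invertible (innovation_cov CC R (embed Ps (Ps + 0)) 0)" using inv by blast
    then show ?thesis using cov[OF psd_zero, of 0] by simp
  qed
  \<comment> \<open>At \<open>\<nu> = 0\<close> the innovation covariance is \<open>(1 + \<alpha>0) W\<close>.\<close>
  have W_pos: "pos_def W"
  proof -
    have "W + \<Sigma>qe = (1 + \<alpha>0) *\<^sub>R W" by (simp add: eW scaleR_add_left)
    with inv_e have "pos_def ((1 + \<alpha>0) *\<^sub>R W)"
      using psd_invertible_pos_def psd_add[OF W psd_e] by metis
    then show ?thesis
      using W \<alpha>0 by (auto simp: pos_def_def psd_def scaleR_matrix_vector_assoc[symmetric] zero_less_mult_iff)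
  qed
  have \<Theta>_pos: "pos_def \<Theta>" unfolding \<Theta>_def by (rule psd_add_pos_def[OF \<Sigma>s W_pos])

  let ?post = "posterior W (\<alpha>1 *\<^sub>R \<Theta>) \<Sigma>qe"
  have L_step: "L (embed Ps (Ps + D)) g \<nu> = embed Ps (Ps + A ** ?post g \<nu> D ** transpose A)"
    if "psd D" "g \<in> {0, 1}" "\<nu> \<in> {0, 1}" for D g \<nu>
    using that(2,3) unfolding step[OF that(1)]
    by (auto simp: posterior_def filtered_cov_def x\<Theta> add_diff_eq ac_simps)
  have post: "psd (?post g \<nu> D)" if "psd D" for D g \<nu>
    using psd_posterior[OF that W _ psd_e _ inv_e] inv_x[OF that] psd_x by (simp add: x\<Theta>)

  \<comment> \<open>If \<open>\<Theta> \<le> t W\<close> with \<open>t \<ge> 1\<close>, then \<open>A \<Theta> A\<^sup>T = \<Theta> - W \<le> (1 - 1/t) \<Theta>\<close>.\<close>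
  obtain \<kappa> where \<kappa>: "0 \<le> \<kappa>" "\<kappa> < 1" and drop: "psd (\<kappa> *\<^sub>R \<Theta> - A ** \<Theta> ** transpose A)"
  proof -
    obtain s where s: "0 < s" "psd (s *\<^sub>R W - \<Theta>)"
      using psd_le_scaleR_pos_def[OF psd_symmetric[OF \<Theta>] W_pos] by blast
    define t where "t = max s 1"
    have t: "1 \<le> t" by (simp add: t_def)
    have "psd ((s *\<^sub>R W - \<Theta>) + (t - s) *\<^sub>R W)"
      by (intro psd_add psd_scaleR W s) (simp add: t_def)
    then have "psd (t *\<^sub>R W - \<Theta>)" by (simp add: algebra_simps)
    from psd_scaleR[OF _ this, of "1 / t"] have "psd (W - (1 / t) *\<^sub>R \<Theta>)"
      using t by (simp add: scaleR_diff_right)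
    moreover have "A ** \<Theta> ** transpose A = \<Theta> - W"
      using lyapunov' by (simp add: \<Theta>_def matrix_ring)
    ultimately have "psd ((1 - 1 / t) *\<^sub>R \<Theta> - A ** \<Theta> ** transpose A)"
      by (simp add: scaleR_diff_left)
    then show ?thesis using that[of "1 - 1 / t"] t by simp
  qed

  define le where "le s x y \<longleftrightarrow> psd (upper_left y + s *\<^sub>R \<Theta> - upper_left x)"
    for s and x y :: "real^('n + 'n)^('n + 'n)"
  define r where "r x \<nu> = lam * trace (upper_left x) + (1 - lam) * J \<nu>"
    for x :: "real^('n + 'n)^('n + 'n)" and \<nu>
  have le_embed: "le s (embed Ps (Ps + D1)) (embed Ps (Ps + D2)) \<longleftrightarrow> psd (D2 + s *\<^sub>R \<Theta> - D1)" for s D1 D2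
    by (simp add: le_def upper_left_embed algebra_simps)
  interpret mdp: contractive_decision_process "state_space Ps" "embed Ps (Ps + 0)" L r "1 - p" le \<kappa>
    "lam * trace \<Theta>" \<kappa>
  proof
    show "embed Ps (Ps + 0) \<in> state_space Ps" using psd_zero by (subst state_space_iff) blast
    show "0 \<le> 1 - p" "1 - p \<le> 1" "0 \<le> \<kappa>" "\<kappa> < 1" using p \<kappa> by auto
    show "0 \<le> lam * trace \<Theta>" using lam psd_trace_nonneg[OF \<Theta>] by simp
  next
    fix x g v assume x: "x \<in> state_space Ps" and gv: "g \<in> {0, 1 :: real}" "v \<in> {0, 1 :: real}"
    then obtain D where D: "psd D" "x = embed Ps (Ps + D)" by (auto simp: state_space_iff)
    show "L x g v \<in> state_space Ps"
      unfolding D(2) L_step[OF D(1) gv] using psd_congruence[OF post[OF D(1)], of A]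
      by (subst state_space_iff) blast
  next
    fix x and v :: real assume x: "x \<in> state_space Ps" and v: "v \<in> {0, 1}"
    then obtain D where D: "psd D" "x = embed Ps (Ps + D)" by (auto simp: state_space_iff)
    have "0 \<le> trace (upper_left x)"
      using psd_trace_nonneg[OF psd_add[OF psd_Ps D(1)]] by (simp add: D(2) upper_left_embed)
    moreover have "0 \<le> J v" using v assms(22-25) by (auto simp: J)
    ultimately show "0 \<le> r x v" using lam by (simp add: r_def)
  next
    fix s v :: real and x y assume "le s x y"
    then have "0 \<le> trace (upper_left y + s *\<^sub>R \<Theta> - upper_left x)"
      unfolding le_def by (rule psd_trace_nonneg)
    then have "trace (upper_left x) \<le> trace (upper_left y) + s * trace \<Theta>"
      by (simp add: trace_add trace_sub trace_scaleR)
    from mult_left_mono[OF this lam(1)] show "r x v \<le> r y v + lam * trace \<Theta> * s"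
      by (simp add: r_def algebra_simps)
  next
    fix s g v :: real and x y
    assume s: "0 \<le> s" and gv: "g \<in> {0, 1}" "v \<in> {0, 1}" and le: "le s x y"
      and "x \<in> state_space Ps" "y \<in> state_space Ps"
    then obtain D1 D2 where D: "psd D1" "x = embed Ps (Ps + D1)" "psd D2" "y = embed Ps (Ps + D2)"
      by (auto simp: state_space_iff)
    have "psd (D2 + s *\<^sub>R \<Theta> - D1)" using le by (simp add: D le_embed)
    from posterior_nonexpansive[OF D(1,3) W \<Theta> \<alpha>1 s inv_x[OF D(1)] inv_x[OF D(3)] this]
    show "le (\<kappa> * s) (L x g v) (L y g v)"
      unfolding D(2,4) L_step[OF D(1) gv] L_step[OF D(3) gv] le_embed
      by (rule contraction_step[OF _ s drop])
  next
    fix x assume "x \<in> state_space Ps"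
    then obtain D where D: "psd D" "x = embed Ps (Ps + D)" by (auto simp: state_space_iff)
    show "le 0 (embed Ps (Ps + 0)) x" unfolding D(2) le_embed using D(1) by simp
    obtain s where "0 < s" "psd (s *\<^sub>R \<Theta> - D)"
      using psd_le_scaleR_pos_def[OF psd_symmetric[OF D(1)] \<Theta>_pos] by blast
    then show "\<exists>s\<ge>0. le s x (embed Ps (Ps + 0))"
      unfolding D(2) le_embed by (intro exI[of _ s]) simp
  next
    fix g v :: real assume gv: "g \<in> {0, 1}" "v \<in> {0, 1}"
    have "psd (0 + W - ?post g v 0)"
      by (rule posterior_le_prior[OF psd_zero W _ psd_e _ inv_e])
        (use inv_x[OF psd_zero] psd_x in \<open>simp_all add: x\<Theta>\<close>)
    with \<Sigma>s have "psd (\<Sigma>s + (0 + W - ?post g v 0))" by (rule psd_add)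
    then have "psd (0 + 1 *\<^sub>R \<Theta> - ?post g v 0)" by (simp add: \<Theta>_def algebra_simps)
    from contraction_step[OF this _ drop]
    show "le \<kappa> (L (embed Ps (Ps + 0)) g v) (embed Ps (Ps + 0))"
      unfolding L_step[OF psd_zero gv] le_embed by (simp add: matrix_mult_zero)
  next
    fix s t :: real and x y z assume "le s x y" "le t y z"
    then show "le (s + t) x z"
      unfolding le_def using psd_add[of "upper_left y + s *\<^sub>R \<Theta> - upper_left x" "upper_left z + t *\<^sub>R \<Theta> - upper_left y"]
      by (simp add: algebra_simps)
  qed

  interpret prob_space M by (rule assms(31))
  interpret reception_process M \<gamma> "1 - p"
    by unfold_locales (use assms(32-34) in auto)
  obtain \<rho> V where acoe: "\<And>x. x \<in> state_space Ps \<Longrightarrow> \<rho> + V x = mdp.bellman 1 V x"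
    and V: "\<And>x s. x \<in> state_space Ps \<Longrightarrow> 0 \<le> s \<Longrightarrow> le s x (embed Ps (Ps + 0)) \<Longrightarrow> 0 \<le> V x \<and> V x \<le> mdp.slope * s"
    using mdp.average_cost_optimality_equation by blast
  let ?Q = "cost_to_go (1 - p) r L V"
  have opt: "\<rho> + V x = min (?Q x 0) (?Q x 1)" if "x \<in> state_space Ps" for x
    using acoe[OF that] by (simp add: mdp.bellman_def)
  have r_eq: "r = (\<lambda>x \<nu>. lam * trace (upper_left x) + (1 - lam) * J \<nu>)" by (simp add: r_def fun_eq_iff)
  show ?thesis
  proof (intro exI[of _ \<rho>] exI[of _ V] conjI allI impI ballI)
    fix P0 assume "psd (P0 - Ps)"
    then have "embed Ps P0 \<in> state_space Ps" by (auto simp: state_space_def)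
    then obtain Y c where Y: "embed Ps P0 \<in> Y" "Y \<subseteq> state_space Ps"
        "\<And>y g v. y \<in> Y \<Longrightarrow> g \<in> {0, 1} \<Longrightarrow> v \<in> {0, 1} \<Longrightarrow> L y g v \<in> Y"
      and c: "\<And>y. y \<in> Y \<Longrightarrow> \<exists>s. 0 \<le> s \<and> s \<le> c \<and> le s y (embed Ps (Ps + 0))"
      using mdp.bounded_invariant_set by metis
    have bounded: "\<bar>V y\<bar> \<le> mdp.slope * c" if y: "y \<in> Y" for y
    proof -
      obtain s where s: "0 \<le> s" "s \<le> c" "le s y (embed Ps (Ps + 0))" using c[OF y] by blast
      have "0 \<le> V y \<and> V y \<le> mdp.slope * s" by (rule V) (use y Y s in auto)
      moreover have "mdp.slope * s \<le> mdp.slope * c" using s mdp.slope_nonneg by (intro mult_left_mono) auto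
      ultimately show ?thesis by linarith
    qed
    show "\<exists>\<pi>\<in>policies. average_cost M \<gamma> L Ps J lam \<pi> P0 = ereal \<rho>"
    proof (rule bexI[OF _ greedy_policy_policies])
      show "average_cost M \<gamma> L Ps J lam (greedy_policy L Ps ?Q) P0 = ereal \<rho>"
        unfolding r_eq
        by (rule greedy_policy_optimal[OF Y(1,3) bounded]) (use opt Y(2) in \<open>auto simp: r_eq\<close>)
    qed
    fix \<pi> :: "'n policy" assume \<pi>: "\<pi> \<in> policies"
    have "\<rho> + V y \<le> cost_to_go (1 - p) (\<lambda>x \<nu>. lam * trace (upper_left x) + (1 - lam) * J \<nu>) L V y u"
      if "y \<in> Y" "u \<in> {0, 1}" for y u
      using that opt[of y] Y(2) by (auto simp: r_eq[symmetric])
    from average_cost_lower_bound[OF Y(1,3) bounded \<pi> this]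
    show "ereal \<rho> \<le> average_cost M \<gamma> L Ps J lam \<pi> P0" .
  next
    fix P assume "P \<in> state_space Ps"
    have expectation: "measure_pmf.expectation (bernoulli_pmf (1 - p))
          (\<lambda>g. lam * trace (upper_left (L P (of_bool g) \<nu>)) + (1 - lam) * J \<nu>)
        + measure_pmf.expectation (bernoulli_pmf (1 - p)) (\<lambda>g. V (L P (of_bool g) \<nu>)) = ?Q P \<nu>" for \<nu>
      using p by (simp add: cost_to_go_def r_def algebra_simps)
    show "\<rho> + V P = Min ((\<lambda>\<nu>.
             measure_pmf.expectation (bernoulli_pmf (1 - p))
               (\<lambda>g. lam * trace (upper_left (L P (of_bool g) \<nu>)) + (1 - lam) * J \<nu>)
             + measure_pmf.expectation (bernoulli_pmf (1 - p))
               (\<lambda>g. V (L P (of_bool g) \<nu>))) ` {0, 1})"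
      unfolding expectation using opt[OF \<open>P \<in> state_space Ps\<close>] by simp
  qed
qed

end
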